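(* Let $k\ge 1$ be an integer. For all $x>0$, $$\mathcal F_k(2x)=\sum_{j=1}^k\binom{k-1}{j-1}\bigg[\sigma_0^{(k-j)}(2)\mathcal F_j(x)-\frac12\log^{k-j}\!\Big(\frac12\Big)\mathcal F_j\!\Big(\frac x2\Big)-\frac12\log^{k-j}\!\Big(\frac12\Big)\mathcal F_j\!\Big(\frac{x+1}2\Big)-\frac1{x+1}\log^{k-j}\!\Big(\frac1{x+1}\Big)\mathcal F_j\!\Big(\frac{2x}{x+1}\Big)\bigg]$$ and $$\mathcal F_k(3x)=\sum_{j=1}^k\binom{k-1}{j-1}\bigg[\sigma_0^{(k-j)}(3)\mathcal F_j(x)-\frac13\log^{k-j}\!\Big(\frac13\Big)\sum_{p=0}^2\mathcal F_j\!\Big(\frac{x+p}3\Big)-\frac1{x+2}\log^{k-j}\!\Big(\frac1{x+2}\Big)\mathcal F_j\!\Big(\frac{2x+1}{x+2}\Big)-\sum_{p=1}^2\frac1{px+1}\log^{k-j}\!\Big(\frac1{px+1}\Big)\mathcal F_j\!\Big(\frac{3x}{px+1}\Big)\bigg].$$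
   Context: Notation: $\log$ is the principal logarithm, $\log^a x=(\log x)^a$ (equal to $1$ when $a=0$), $\zeta$ is the Riemann zeta function, and $\gamma_m$ are the Stieltjes (generalized Euler) constants, $\zeta(s)=\frac1{s-1}+\sum_{m\ge 0}\frac{(-1)^m\gamma_m}{m!}(s-1)^m$. $\sigma_0^{(j)}(n)$ denotes the $j$-th derivative with respect to $s$, at $s=1$, of $\sigma_{1-s}(n)=\sum_{d\mid n}d^{1-s}$. Generalized gamma function: for $k\ge 0$ and $x\in\mathbb C\setminus(-\infty,0]$, $$\Gamma_k(x)=\lim_{n\to\infty}\frac{\exp\!\big(\frac{\log^{k+1}n}{k+1}x\big)\prod_{j=1}^n\exp\!\big(\frac{\log^{k+1}j}{k+1}\big)}{\prod_{j=0}^n\exp\!\big(\frac{\log^{k+1}(j+x)}{k+1}\big)},\qquad \psi_k(x)=\frac{\Gamma_k'(x)}{\Gamma_k(x)}$$ (so $\psi_k(x)=\lim_{n\to\infty}\big(\frac{\log^{k+1}n}{k+1}-\sum_{j=0}^n\frac{\log^k(j+x)}{j+x}\big)$). For $k\ge 1$ and $x\in\mathbb C\setminus(-\infty,0]$, $$\mathfrak F_k^0(x)=\sum_{n=1}^\infty\left[\psi_{k-1}(nx)+\frac{\log^{k-1}(nx)}{2nx}-\frac{\log^k(nx)}{k}\right],$$ $$\mathcal F_k(x)=(-1)^{k-1}\mathfrak F_k^0(x)-\sum_{l=0}^k\frac{(-1)^l}{k}\binom kl\log^l(x)\,\zeta^{(k-l)}(0)-\frac12(-1)^{k-1}\gamma_{k-1}.$$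 *)

theory Defs
  imports "HOL-Complex_Analysis.Complex_Analysis"
begin

text \<open>
  The value at the pole \<open>s = 1\<close> is left unspecified; everywhere else the function is determined,
  by uniqueness of analytic continuation.
\<close>
definition zeta :: "complex \<Rightarrow> complex" where
  "zeta = (SOME f. f holomorphic_on - {1} \<and>
     (\<forall>s. Re s > 1 \<longrightarrow> (\<lambda>n. 1 / of_nat (Suc n) powr s) sums f s))"

text \<open>
  From \<open>\<zeta>(s) = 1 / (s - 1) + (\<Sum>m\<ge>0. (-1)\<^sup>m \<gamma>\<^sub>m / m! (s - 1)\<^sup>m)\<close>:
  \<open>laurent_expansion zeta 1\<close> is the Laurent series of \<open>\<zeta>(1 + z)\<close> in \<open>z\<close>.
\<close>
definition stieltjes :: "nat \<Rightarrow> complex" where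
  "stieltjes m = (-1) ^ m * fact m * fls_nth (laurent_expansion zeta 1) (int m)"

definition divisor_sigma :: "complex \<Rightarrow> nat \<Rightarrow> complex" where
  "divisor_sigma z n = (\<Sum>d | d dvd n. of_nat d powr z)"

definition sigma0_deriv :: "nat \<Rightarrow> nat \<Rightarrow> complex" where
  "sigma0_deriv j n = (deriv ^^ j) (\<lambda>s. divisor_sigma (1 - s) n) 1"

text \<open>The functions below are meaningful for \<open>x \<notin> \<real>\<^sub>\<le>\<^sub>0\<close>.\<close>

definition gen_Gamma :: "nat \<Rightarrow> complex \<Rightarrow> complex" where
  "gen_Gamma k x = lim (\<lambda>n.
     exp (Ln (of_nat n) ^ (k + 1) / of_nat (k + 1) * x)
       * (\<Prod>j=1..n. exp (Ln (of_nat j) ^ (k + 1) / of_nat (k + 1)))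
       / (\<Prod>j=0..n. exp (Ln (of_nat j + x) ^ (k + 1) / of_nat (k + 1))))"

definition gen_psi :: "nat \<Rightarrow> complex \<Rightarrow> complex" where
  "gen_psi k x = deriv (gen_Gamma k) x / gen_Gamma k x"

text \<open>
  The next two definitions are meant for \<open>k \<ge> 1\<close> only, so that \<open>k - 1\<close> is the true predecessor.
  The series over \<open>n \<ge> 1\<close> is indexed by \<open>n = Suc m\<close>.
\<close>
definition frakF0 :: "nat \<Rightarrow> complex \<Rightarrow> complex" where
  "frakF0 k x = (\<Sum>m. let y = of_nat (Suc m) * x in
     gen_psi (k - 1) y + Ln y ^ (k - 1) / (2 * y) - Ln y ^ k / of_nat k)"

definition calF :: "nat \<Rightarrow> complex \<Rightarrow> complex" where
  "calF k x =
     (-1) ^ (k - 1) * frakF0 k x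
     - (\<Sum>l=0..k. (-1) ^ l / of_nat k * of_nat (k choose l) * Ln x ^ l * (deriv ^^ (k - l)) zeta 0)
     - 1 / 2 * (-1) ^ (k - 1) * stieltjes (k - 1)"

end

(*
  The functions F_k are the Taylor coefficients at w = 1 of one function of w: with
    Phi(w, x) = (w - 1) (sum of v(m, n) (m x + n)^(-w) over m, n >= 0, (m, n) /= (0, 0)),
  where v = 1 in the interior of the quadrant and v = 1/2 on its boundary, one has
  k F_k(x) = - (d/dw)^k Phi(w, x) at w = 1, for the continuation of Phi to Re w > 0. The continuation comes
  from the trapezoidal rule in n; its value at w = 1 is zeta(0) + 1/2 = 0. For Re w > 2 the
  terms of the relations for Phi(w, p x), p = 2 or 3, enumerate the p + 1 sublattices of index p of the lattice of
  points (a, b), each cut into cones. A point lies in all p + 1 of them if p divides a and b, and in exactly one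
  otherwise, so the total is Phi(w, x) + p^(1 - w) Phi(w, x) = sigma_(1-w)(p) Phi(w, x). The relations extend
  to w = 1 by the identity theorem, and the Leibniz rule produces the binomial coefficients and the powers of
  logarithms.
*)

theory Submission
  imports Defs
begin

subsection \<open>Holomorphic sums over half planes\<close>

text \<open>Boundary weight 1/2 makes the sums additive under subdivision: a ray shared by two cones
  receives 1/2 from each, the full weight of an inner point. It is also the end point weight of the
  trapezoidal rule, and so the source of the terms \<open>Ln y ^ (k - 1) / (2 * y)\<close> in
  \<open>frakF0\<close> and of the factor 1/2 at the Stieltjes constants in \<open>calF\<close>. The
  obstacle is the distance between \<open>Re w > 2\<close>, where the lattice sums converge, and the
  point \<open>w = 1\<close>, with a pole at \<open>w = 2\<close> on the way. The error of the
  trapezoidal rule is smaller than the summand by two powers, which is just enough to reach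
  \<open>Re w > 0\<close>; the part that the rule splits off is expressed by \<zeta>. Since
  \<open>zeta\<close> is specified by a choice, its continuation and its value at 0 are derived from
  the series. Powers of logarithms enter as derivatives of complex powers in \<open>w\<close>, so
  that their sums are governed by theorems on holomorphic functions instead of direct
  estimates.\<close>

lemma higher_deriv_finite_sum:
  fixes f :: "'i \<Rightarrow> complex \<Rightarrow> complex"
  assumes "finite I" "\<And>i. i \<in> I \<Longrightarrow> f i holomorphic_on A" "open A" "z \<in> A"
  shows "(deriv ^^ k) (\<lambda>w. \<Sum>i\<in>I. f i w) z = (\<Sum>i\<in>I. (deriv ^^ k) (f i) z)"
  using assms(1,2)
proof (induction I rule: finite_induct)
  case empty
  then show ?case by simp
next
  case (insert i I)
  have "(deriv ^^ k) (\<lambda>w. f i w + (\<Sum>i\<in>I. f i w)) z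
      = (deriv ^^ k) (f i) z + (deriv ^^ k) (\<lambda>w. \<Sum>i\<in>I. f i w) z"
    using insert.prems assms(3,4) by (intro higher_deriv_add[of _ A] holomorphic_on_sum) auto
  then show ?case
    using insert by simp
qed

text \<open>Weierstrass's theorem for unordered sums: the finite partial sums converge uniformly on
  small balls, and derivatives commute with such limits. The majorant may depend on \<sigma> and
  \<open>B\<close>, because bounds for complex powers deteriorate as \<open>Re w\<close> decreases
  and as \<open>norm w\<close> grows.\<close>

lemma
  fixes f :: "'i \<Rightarrow> complex \<Rightarrow> complex"
  assumes holo: "\<And>i. i \<in> I \<Longrightarrow> f i holomorphic_on {w. Re w > a}"
    and dom: "\<And>\<sigma> B. \<sigma> > a \<Longrightarrow> \<exists>M. M summable_on I \<and>
                (\<forall>i\<in>I. \<forall>w. \<sigma> \<le> Re w \<longrightarrow> norm w \<le> B \<longrightarrow> norm (f i w) \<le> M i)"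
  shows holomorphic_on_infsum_halfplane: "(\<lambda>w. \<Sum>\<^sub>\<infinity>i\<in>I. f i w) holomorphic_on {w. Re w > a}"
    and has_sum_higher_deriv_halfplane: "Re z > a \<Longrightarrow>
      ((\<lambda>i. (deriv ^^ k) (f i) z) has_sum (deriv ^^ k) (\<lambda>w. \<Sum>\<^sub>\<infinity>i\<in>I. f i w) z) I"
proof -
  have local: "\<exists>r>0. ball z r \<subseteq> {w. Re w > a} \<and>
      uniform_limit (ball z r) (\<lambda>X w. \<Sum>i\<in>X. f i w) (\<lambda>w. \<Sum>\<^sub>\<infinity>i\<in>I. f i w) (finite_subsets_at_top I)"
    if "Re z > a" for z
  proof -
    \<comment> \<open>With half the distance to the boundary line as radius, the ball stays in
      \<open>Re w \<ge> a + r\<close>, where one majorant serves all its points.\<close>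
    define r where "r = (Re z - a) / 2"
    have r: "r > 0" using that by (simp add: r_def)
    obtain M where M: "M summable_on I"
      "\<And>i w. i \<in> I \<Longrightarrow> a + r \<le> Re w \<Longrightarrow> norm w \<le> norm z + r \<Longrightarrow> norm (f i w) \<le> M i"
      using dom[of "a + r" "norm z + r"] r by fastforce
    have w: "a + r \<le> Re w \<and> norm w \<le> norm z + r" if "w \<in> ball z r" for w
    proof -
      have "norm (z - w) < r" using that by (simp add: dist_norm)
      moreover have "Re z - Re w \<le> norm (z - w)" using complex_Re_le_cmod[of "z - w"] by simp
      moreover have "norm w \<le> norm z + norm (z - w)" by norm
      ultimately show ?thesis by (simp add: r_def field_simps)
    qed
    have "uniform_limit (ball z r) (\<lambda>X w. \<Sum>i\<in>X. f i w) (\<lambda>w. \<Sum>\<^sub>\<infinity>i\<in>I. f i w) (finite_subsets_at_top I)"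
      by (rule Weierstrass_m_test_general[OF _ M(1)]) (use w M(2) in auto)
    moreover have "ball z r \<subseteq> {w. Re w > a}"
      using w r by force
    ultimately show ?thesis using r by blast
  qed
  have ev: "eventually (\<lambda>X. finite X \<and> X \<subseteq> I) (finite_subsets_at_top I)"
    by (auto simp: eventually_finite_subsets_at_top)
  have open_A: "open {w. Re w > a}"
    by (simp add: open_halfspace_Re_gt)
  show "(\<lambda>w. \<Sum>\<^sub>\<infinity>i\<in>I. f i w) holomorphic_on {w. Re w > a}"
  proof -
    have "(\<lambda>w. \<Sum>\<^sub>\<infinity>i\<in>I. f i w) analytic_on {w. Re w > a}"
      unfolding analytic_on_def
    proof
      fix z assume "z \<in> {w. Re w > a}"
      then obtain r where r: "r > 0" "ball z r \<subseteq> {w. Re w > a}"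
        "uniform_limit (ball z r) (\<lambda>X w. \<Sum>i\<in>X. f i w) (\<lambda>w. \<Sum>\<^sub>\<infinity>i\<in>I. f i w) (finite_subsets_at_top I)"
        using local[of z] by auto
      have sub: "cball z (r/2) \<subseteq> ball z r" using r(1) by auto
      have hol: "(\<lambda>w. \<Sum>i\<in>X. f i w) holomorphic_on {w. Re w > a}" if "X \<subseteq> I" for X
        using that by (intro holomorphic_on_sum holo) auto
      have "eventually (\<lambda>X. continuous_on (cball z (r/2)) (\<lambda>w. \<Sum>i\<in>X. f i w) \<and>
              (\<lambda>w. \<Sum>i\<in>X. f i w) holomorphic_on ball z (r/2)) (finite_subsets_at_top I)"
        using ev
      proof eventually_elim
        case (elim X)
        then have h: "(\<lambda>w. \<Sum>i\<in>X. f i w) holomorphic_on cball z (r/2)"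
          using hol[of X] sub r(2) by (auto elim!: holomorphic_on_subset)
        then show ?case
          using holomorphic_on_imp_continuous_on[OF h] holomorphic_on_subset[OF h ball_subset_cball] by auto
      qed
      then obtain "(\<lambda>w. \<Sum>\<^sub>\<infinity>i\<in>I. f i w) holomorphic_on ball z (r/2)"
        using uniform_limit_on_subset[OF r(3) sub]
        by (rule holomorphic_uniform_limit) auto
      then show "\<exists>e>0. (\<lambda>w. \<Sum>\<^sub>\<infinity>i\<in>I. f i w) holomorphic_on ball z e"
        using r(1) by (intro exI[of _ "r/2"]) auto
    qed
    then show ?thesis by (rule analytic_imp_holomorphic)
  qed
  show "((\<lambda>i. (deriv ^^ k) (f i) z) has_sum (deriv ^^ k) (\<lambda>w. \<Sum>\<^sub>\<infinity>i\<in>I. f i w) z) I"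
    if z: "Re z > a"
  proof -
    obtain r where r: "r > 0" "ball z r \<subseteq> {w. Re w > a}"
      "uniform_limit (ball z r) (\<lambda>X w. \<Sum>i\<in>X. f i w) (\<lambda>w. \<Sum>\<^sub>\<infinity>i\<in>I. f i w) (finite_subsets_at_top I)"
      using local[OF z] by auto
    have "((\<lambda>X. (deriv ^^ k) (\<lambda>w. \<Sum>i\<in>X. f i w) z) \<longlongrightarrow> (deriv ^^ k) (\<lambda>w. \<Sum>\<^sub>\<infinity>i\<in>I. f i w) z)
            (finite_subsets_at_top I)"
    proof (rule higher_deriv_complex_uniform_limit[OF r(3)])
      show "eventually (\<lambda>X. (\<lambda>w. \<Sum>i\<in>X. f i w) holomorphic_on ball z r) (finite_subsets_at_top I)"
        using ev by eventually_elim
          (use r(2) in \<open>auto intro!: holomorphic_on_sum intro: holomorphic_on_subset[OF holo]\<close>)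
    qed (use r in auto)
    moreover have "eventually (\<lambda>X. (deriv ^^ k) (\<lambda>w. \<Sum>i\<in>X. f i w) z = (\<Sum>i\<in>X. (deriv ^^ k) (f i) z))
            (finite_subsets_at_top I)"
      using ev by eventually_elim (rule higher_deriv_finite_sum[OF _ _ open_A], use z holo in auto)
    ultimately show ?thesis
      unfolding has_sum_def by (rule Lim_transform_eventually)
  qed
qed

section \<open>Size of complex powers and the error of the trapezoidal rule\<close>

text \<open>The argument of \<open>z\<close> contributes only the factor
  \<open>exp (Im w * Arg z)\<close>. The gauge \<open>u\<close> stands for a lower bound of
  \<open>norm z\<close> up to the constant \<open>c\<close>; since \<open>c \<le> 1\<close> and
  \<open>Re w \<le> B\<close>, the constant costs at most \<open>c powr (-B)\<close>.\<close>

lemma norm_powr_uminus_le: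
  fixes z w :: complex
  assumes "c * u \<le> norm z" "0 < c" "c \<le> 1" "1 \<le> u" "0 \<le> \<sigma>" "\<sigma> \<le> Re w" "norm w \<le> B"
  shows "norm (z powr (-w)) \<le> exp (pi * B) * c powr (-B) * u powr (-\<sigma>)"
proof -
  have zpos: "norm z > 0"
    using assms by (smt (verit) mult_pos_pos)
  have "norm z powr (- Re w) \<le> (c * u) powr (- Re w)"
    using assms by (intro powr_mono2') auto
  also have "\<dots> = c powr (- Re w) * u powr (- Re w)"
    using assms by (simp add: powr_mult)
  also have "\<dots> \<le> c powr (-B) * u powr (-\<sigma>)"
  proof (intro mult_mono)
    have "Re w \<le> B" using complex_Re_le_cmod[of w] assms by linarith
    then show "c powr (- Re w) \<le> c powr (-B)" using assms by (intro powr_mono') auto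
    show "u powr (- Re w) \<le> u powr (-\<sigma>)" using assms by (intro powr_mono) auto
  qed auto
  finally have 1: "norm z powr (- Re w) \<le> c powr (-B) * u powr (-\<sigma>)" .
  have "Im w * Arg z \<le> \<bar>Im w\<bar> * \<bar>Arg z\<bar>"
    by (metis abs_ge_self abs_mult)
  also have "\<dots> \<le> B * pi"
    using abs_Im_le_cmod[of w] assms Arg_bounded[of z] by (intro mult_mono) auto
  finally have 2: "exp (Im w * Arg z) \<le> exp (pi * B)" by (simp add: mult.commute)
  have "norm (z powr (-w)) = norm z powr (- Re w) * exp (Im w * Arg z)"
    by (simp add: norm_powr_complex)
  also have "\<dots> \<le> (c powr (-B) * u powr (-\<sigma>)) * exp (pi * B)"
    using 1 2 by (intro mult_mono) auto
  finally show ?thesis by (simp add: mult_ac)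
qed

text \<open>
  \<open>w - 1\<close> times the error of the trapezoidal rule for \<open>t \<mapsto> (z + t)\<^bsup>-w\<^esup>\<close> on \<open>[0, 1]\<close>; the factor removes the
  pole of the primitive at \<open>w = 1\<close>.
\<close>
definition trapezoid_defect :: "complex \<Rightarrow> complex \<Rightarrow> complex" where
  "trapezoid_defect w z = (w - 1) / 2 * (z powr (-w) + (z + 1) powr (-w)) + (z + 1) powr (1 - w) - z powr (1 - w)"

lemma Re_pos_notin_nonpos_Reals: "Re z > 0 \<Longrightarrow> z \<notin> \<real>\<^sub>\<le>\<^sub>0"
  using complex_nonpos_Reals_iff by force

lemma norm_add_Re_ge: "Re z > 0 \<Longrightarrow> Re t \<ge> 0 \<Longrightarrow> Im t = 0 \<Longrightarrow> norm z \<le> norm (z + t)"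
  by (auto simp: cmod_def intro!: real_sqrt_le_mono power_mono)

text \<open>As a function of the interval length \<open>t\<close>, the defect on
  \<open>[0, t]\<close> has a double zero at \<open>t = 0\<close>, and its second derivative is a
  multiple of \<open>(z + t) powr (-w - 2)\<close>. Taylor's formula therefore gains two powers of
  \<open>z\<close> over the summand.\<close>

lemma norm_trapezoid_defect_le:
  assumes "Re z > 0" "c * u \<le> norm z" "0 < c" "c \<le> 1" "1 \<le> u"
    and "-2 \<le> \<sigma>" "\<sigma> \<le> Re w" "norm w \<le> B"
  shows "norm (trapezoid_defect w z) \<le> (B + 1) ^ 3 * exp (pi * (B + 2)) * c powr (-(B + 2)) * u powr (-(\<sigma> + 2))"
proof -
  let ?S = "closed_segment (0::complex) 1"
  define K where "K = exp (pi * (B + 2)) * c powr (-(B + 2)) * u powr (-(\<sigma> + 2))"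
  \<comment> \<open>\<open>f 0 t\<close> is the defect on \<open>[0, t]\<close>; \<open>f 1\<close>
    and \<open>f 2\<close> are its derivatives in \<open>t\<close>.\<close>
  define f where "f = (\<lambda>i::nat. \<lambda>t.
    if i = 0 then (w - 1) * t / 2 * (z powr (-w) + (z + t) powr (-w)) + (z + t) powr (1 - w) - z powr (1 - w)
    else if i = 1 then (w - 1) / 2 * (z powr (-w) + (z + t) powr (-w))
           + (w - 1) * t / 2 * (-w * (z + t) powr (-w - 1)) + (1 - w) * (z + t) powr (-w)
    else (w - 1) * t / 2 * (w * (w + 1) * (z + t) powr (-w - 2)))"
  have S: "0 \<le> Re t \<and> Re t \<le> 1 \<and> Im t = 0" if "t \<in> ?S" for t
    using that by (auto simp: in_segment)
  have nz: "z + t \<notin> \<real>\<^sub>\<le>\<^sub>0" if "t \<in> ?S" for t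
    using S[OF that] assms(1) by (intro Re_pos_notin_nonpos_Reals) auto
  have "norm (f 0 1 - (\<Sum>i\<le>1. f i 0 * (1 - 0) ^ i / fact i))
      \<le> ((B + 1) ^ 3 * K) * norm (1 - 0 :: complex) ^ Suc 1 / fact 1"
  proof (rule complex_Taylor[where S = ?S])
    fix i :: nat and t assume t: "t \<in> ?S" and "i \<le> 1"
    then consider "i = 0" | "i = 1" by linarith
    then show "(f i has_field_derivative f (Suc i) t) (at t within ?S)"
    proof cases
      case 1
      have "((\<lambda>t. (w - 1) * t / 2 * (z powr (-w) + (z + t) powr (-w)) + (z + t) powr (1 - w) - z powr (1 - w))
         has_field_derivative f 1 t) (at t within ?S)"
        unfolding f_def using nz[OF t]
        by (auto intro!: derivative_eq_intros simp: field_simps)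
      then show ?thesis using 1 by (simp add: f_def)
    next
      case 2
      have "((\<lambda>t. (w - 1) / 2 * (z powr (-w) + (z + t) powr (-w))
           + (w - 1) * t / 2 * (-w * (z + t) powr (-w - 1)) + (1 - w) * (z + t) powr (-w))
         has_field_derivative f 2 t) (at t within ?S)"
        unfolding f_def using nz[OF t]
        by (auto intro!: derivative_eq_intros simp: algebra_simps minus_diff_commute)
           (simp add: field_simps)
      then show ?thesis using 2 by (simp add: f_def numeral_2_eq_2)
    qed
  next
    fix t assume t: "t \<in> ?S"
    have "norm z \<le> norm (z + t)"
      using S[OF t] assms(1) by (intro norm_add_Re_ge) auto
    then have "norm ((z + t) powr (-(w + 2))) \<le> K"
      unfolding K_def using assms norm_triangle_ineq[of w 2]
      by (intro norm_powr_uminus_le) auto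
    then have K: "norm ((z + t) powr (-w - 2)) \<le> K" by simp
    have "norm t \<le> 1" using S[OF t] by (simp add: cmod_def)
    moreover have "norm (w - 1) \<le> B + 1" "norm (w + 1) \<le> B + 1" "norm w \<le> B + 1" "0 \<le> B"
      using assms norm_triangle_ineq[of w 1] norm_triangle_ineq4[of w 1] norm_ge_zero[of w]
      by (simp, simp, simp, linarith)
    ultimately have "norm (w - 1) * norm t / 2 * (norm w * norm (w + 1) * norm ((z + t) powr (-w - 2)))
      \<le> (B + 1) * 2 / 2 * ((B + 1) * (B + 1) * K)"
      using K by (intro mult_mono divide_right_mono) auto
    then show "norm (f (Suc 1) t) \<le> (B + 1) ^ 3 * K"
      by (simp add: f_def norm_mult norm_divide power3_eq_cube mult_ac)
  qed auto
  moreover have "(\<Sum>i\<le>1. f i 0 * (1 - 0) ^ i / fact i) = 0"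
    by (simp add: f_def field_simps)
  moreover have "f 0 1 = trapezoid_defect w z" by (simp add: f_def trapezoid_defect_def)
  ultimately show ?thesis by (simp add: K_def mult_ac)
qed

subsection \<open>The Riemann zeta function\<close>

lemma summable_on_Suc_powr:
  assumes "\<sigma> > 1"
  shows "(\<lambda>n. real (Suc n) powr (-\<sigma>)) summable_on UNIV"
proof (rule norm_summable_imp_summable_on)
  have "summable (\<lambda>n. real n powr (-\<sigma>))"
    using assms by (simp add: summable_real_powr_iff)
  then show "summable (\<lambda>n. norm (real (Suc n) powr (-\<sigma>)))"
    using summable_Suc_iff[of "\<lambda>n. real n powr (-\<sigma>)"] by simp
qed

lemma norm_Suc_powr_le:
  assumes "0 \<le> \<sigma>" "\<sigma> \<le> Re w" "norm w \<le> B"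
  shows "norm ((of_nat (Suc n) :: complex) powr (-w)) \<le> exp (pi * B) * real (Suc n) powr (-\<sigma>)"
  using norm_powr_uminus_le[of 1 "real (Suc n)" "of_nat (Suc n)" \<sigma> w B] assms
  by (simp del: of_nat_Suc)

definition zeta_series :: "complex \<Rightarrow> complex" where
  "zeta_series w = (\<Sum>\<^sub>\<infinity>n. of_nat (Suc n) powr (-w))"

lemma zeta_series_holomorphic: "zeta_series holomorphic_on {w. Re w > 1}"
  unfolding zeta_series_def
proof (rule holomorphic_on_infsum_halfplane)
  fix \<sigma> B :: real assume "\<sigma> > 1"
  then show "\<exists>M. M summable_on UNIV \<and> (\<forall>n\<in>UNIV. \<forall>w. \<sigma> \<le> Re w \<longrightarrow> norm w \<le> B \<longrightarrow>
               norm ((of_nat (Suc n) :: complex) powr (-w)) \<le> M n)"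
    by (intro exI[of _ "\<lambda>n. exp (pi * B) * real (Suc n) powr (-\<sigma>)"] conjI summable_on_cmult_right
          summable_on_Suc_powr) (auto intro!: norm_Suc_powr_le simp del: of_nat_Suc)
qed (auto intro!: holomorphic_intros simp del: of_nat_Suc)

lemma zeta_series_has_sum:
  assumes "Re w > 1"
  shows "((\<lambda>n. of_nat (Suc n) powr (-w)) has_sum zeta_series w) UNIV"
  unfolding zeta_series_def
proof (rule has_sum_infsum)
  have "(\<lambda>n. exp (pi * norm w) * real (Suc n) powr (-Re w)) summable_on UNIV"
    using assms by (intro summable_on_cmult_right summable_on_Suc_powr)
  then have "(\<lambda>n. norm ((of_nat (Suc n) :: complex) powr (-w))) summable_on UNIV"
    by (rule summable_on_comparison_test)
       (use assms in \<open>auto intro!: norm_Suc_powr_le simp del: of_nat_Suc\<close>)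
  then show "(\<lambda>n. (of_nat (Suc n) :: complex) powr (-w)) summable_on UNIV"
    by (rule abs_summable_summable)
qed

text \<open>
  Continuation of \<open>\<zeta>\<close>: the binomial expansion of \<open>(n + 1)\<^bsup>1 - w\<^esup> - n\<^bsup>1 - w\<^esup>\<close> to order \<open>K\<close>, summed over
  \<open>n \<ge> 1\<close>, telescopes on one side and expresses \<open>(w - 1) \<zeta>(w)\<close> by the values at \<open>w + 1, \<dots>, w + K - 1\<close>
  and a remainder that converges for \<open>Re w > 1 - K\<close>.
\<close>
definition falling_prod :: "nat \<Rightarrow> complex \<Rightarrow> complex" where
  "falling_prod i s = (\<Prod>j<i. s - of_nat j)"

definition binomial_remainder :: "nat \<Rightarrow> complex \<Rightarrow> complex \<Rightarrow> complex" where
  "binomial_remainder K w z = (z + 1) powr (1 - w) - (\<Sum>i\<le>K. falling_prod i (1 - w) / fact i * z powr (1 - w - of_nat i))"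

lemma falling_prod_Suc: "falling_prod (Suc i) s = falling_prod i s * (s - of_nat i)"
  by (simp add: falling_prod_def)

lemma falling_prod_holomorphic [holomorphic_intros]:
  "f holomorphic_on A \<Longrightarrow> (\<lambda>w. falling_prod i (f w)) holomorphic_on A"
  unfolding falling_prod_def by (intro holomorphic_intros)

text \<open>Taylor's formula for \<open>(z + t) powr (1 - w)\<close> on \<open>[0, 1]\<close>: the
  derivative of order \<open>K + 1\<close> carries the exponent \<open>-(w + K)\<close>.\<close>

lemma norm_binomial_remainder_le:
  assumes "0 \<le> \<sigma> + real K" "\<sigma> \<le> Re w" "norm w \<le> B"
  shows "norm (binomial_remainder K w (of_nat (Suc n)))
     \<le> (B + 1 + K) ^ Suc K * exp (pi * (B + K)) * real (Suc n) powr (-(\<sigma> + K))"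
proof -
  let ?S = "closed_segment (0::complex) 1"
  define z where "z = (of_nat (Suc n) :: complex)"
  have z: "Re z > 0" "norm z = real (Suc n)" by (simp_all add: z_def del: of_nat_Suc)
  define M where "M = exp (pi * (B + K)) * real (Suc n) powr (-(\<sigma> + K))"
  have S: "0 \<le> Re t \<and> Re t \<le> 1 \<and> Im t = 0" if "t \<in> ?S" for t
    using that by (auto simp: in_segment)
  have nz: "z + t \<notin> \<real>\<^sub>\<le>\<^sub>0" if "t \<in> ?S" for t
    using S[OF that] z(1) by (intro Re_pos_notin_nonpos_Reals) auto
  define f where "f = (\<lambda>i t. falling_prod i (1 - w) * (z + t) powr (1 - w - of_nat i))"
  have B: "0 \<le> B" using assms(3) norm_ge_zero[of w] by linarith
  have "norm (falling_prod (Suc K) (1 - w)) \<le> (\<Prod>j<Suc K. B + 1 + K)"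
    unfolding falling_prod_def prod_norm[symmetric]
  proof (intro prod_mono conjI)
    fix j assume "j \<in> {..<Suc K}"
    then have "norm (1 - w - of_nat j) \<le> norm (1 - w) + real K"
      using norm_triangle_ineq4[of "1 - w" "of_nat j"] by simp
    then show "norm (1 - w - of_nat j) \<le> B + 1 + K"
      using norm_triangle_ineq4[of 1 w] assms(3) by simp
  qed simp
  then have P: "norm (falling_prod (Suc K) (1 - w)) \<le> (B + 1 + K) ^ Suc K" by simp
  have "norm (f 0 1 - (\<Sum>i\<le>K. f i 0 * (1 - 0) ^ i / fact i))
      \<le> ((B + 1 + K) ^ Suc K * M) * norm (1 - 0 :: complex) ^ Suc K / fact K"
  proof (rule complex_Taylor[where S = ?S])
    fix i :: nat and t assume t: "t \<in> ?S"
    show "(f i has_field_derivative f (Suc i) t) (at t within ?S)"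
      unfolding f_def falling_prod_Suc using nz[OF t]
      by (auto intro!: derivative_eq_intros simp: algebra_simps)
  next
    fix t assume t: "t \<in> ?S"
    have "norm z \<le> norm (z + t)"
      using S[OF t] z(1) by (intro norm_add_Re_ge) auto
    then have "norm ((z + t) powr (-(w + of_nat K))) \<le> exp (pi * (B + K)) * 1 powr (-(B + K)) * real (Suc n) powr (-(\<sigma> + K))"
      using assms norm_triangle_ineq[of w "of_nat K"] z(2)
      by (intro norm_powr_uminus_le) auto
    then have "norm ((z + t) powr (1 - w - of_nat (Suc K))) \<le> M"
      by (simp add: M_def algebra_simps)
    with P show "norm (f (Suc K) t) \<le> (B + 1 + K) ^ Suc K * M"
      unfolding f_def norm_mult using B by (intro mult_mono) auto
  qed auto
  also have "\<dots> \<le> (B + 1 + K) ^ Suc K * M"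
    using B mult_left_mono[OF fact_ge_1, of "(B + 1 + K) ^ Suc K * M" K]
    by (simp add: M_def divide_le_eq)
  also have "f 0 1 - (\<Sum>i\<le>K. f i 0 * (1 - 0) ^ i / fact i) = binomial_remainder K w z"
    by (simp add: f_def binomial_remainder_def falling_prod_def)
  finally show ?thesis by (simp add: z_def M_def mult_ac)
qed

definition binomial_remainder_sum :: "nat \<Rightarrow> complex \<Rightarrow> complex" where
  "binomial_remainder_sum K w = (\<Sum>\<^sub>\<infinity>n. binomial_remainder K w (of_nat (Suc n)))"

lemma binomial_remainder_sum_holomorphic: "binomial_remainder_sum K holomorphic_on {w. Re w > 1 - real K}"
  unfolding binomial_remainder_sum_def
proof (rule holomorphic_on_infsum_halfplane)
  fix \<sigma> B :: real assume *: "\<sigma> > 1 - real K"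
  have "norm (binomial_remainder K w (of_nat (Suc n)))
      \<le> (B + 1 + K) ^ Suc K * exp (pi * (B + K)) * real (Suc n) powr (-(\<sigma> + K))"
    if "\<sigma> \<le> Re w" "norm w \<le> B" for n w
    using that * by (intro norm_binomial_remainder_le) auto
  moreover have "(\<lambda>n. (B + 1 + K) ^ Suc K * exp (pi * (B + K)) * real (Suc n) powr (-(\<sigma> + K))) summable_on UNIV"
    using * by (intro summable_on_cmult_right summable_on_Suc_powr) auto
  ultimately show "\<exists>M. M summable_on UNIV \<and> (\<forall>n\<in>UNIV. \<forall>w. \<sigma> \<le> Re w \<longrightarrow> norm w \<le> B \<longrightarrow>
               norm (binomial_remainder K w (of_nat (Suc n))) \<le> M n)"
    by blast
qed (auto simp: binomial_remainder_def intro!: holomorphic_intros simp del: of_nat_Suc)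

text \<open>In the term of order \<open>j + 1\<close> the last factor of the falling product is
  \<open>-(w + j - 1)\<close>. Splitting it off makes every value appear in the combination
  \<open>(s - 1) * \<zeta>(s)\<close> at \<open>s = w + j\<close>, which is free of poles;
  \<open>j = 0\<close> is the left-hand side. The 1 on the right comes from the telescoping sum,
  which starts at \<open>1 powr (1 - w)\<close>.\<close>

lemma zeta_series_recursion:
  assumes w: "Re w > 1" and K: "K \<ge> 1"
  shows "(w - 1) * zeta_series w = 1 + binomial_remainder_sum K w
           - (\<Sum>j=1..<K. falling_prod j (1 - w) / fact (Suc j) * ((w + of_nat j - 1) * zeta_series (w + of_nat j)))"
proof -
  have binomial_remainder_eq: "binomial_remainder K w z = ((z + 1) powr (1 - w) - z powr (1 - w))
     + (\<Sum>j<K. falling_prod j (1 - w) * (w + of_nat j - 1) / fact (Suc j) * z powr (- (w + of_nat j)))" for z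
  proof -
    have "falling_prod (Suc j) (1 - w) / fact (Suc j) * z powr (1 - w - of_nat (Suc j))
        = - (falling_prod j (1 - w) * (w + of_nat j - 1) / fact (Suc j) * z powr (- (w + of_nat j)))" for j
      by (simp add: falling_prod_Suc field_simps del: fact_Suc)
    then show ?thesis
      unfolding binomial_remainder_def sum.atMost_shift by (simp add: sum_negf falling_prod_def del: fact_Suc)
  qed
  have lim: "(\<lambda>n. (of_nat (Suc n) :: complex) powr (1 - w)) \<longlonglongrightarrow> 0"
  proof -
    have "filterlim (\<lambda>n. real (Suc n)) at_top sequentially"
      by (rule filterlim_compose[OF filterlim_real_sequentially filterlim_Suc])
    from tendsto_neg_powr_complex_of_real[OF this, of "1 - w"] show ?thesis
      using w by (simp del: of_nat_Suc)
  qed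
  have "(\<lambda>n. (of_nat (Suc n) + 1) powr (1 - w) - (of_nat (Suc n) :: complex) powr (1 - w)) sums (0 - 1)"
    using telescope_sums[OF lim] by (simp add: add_ac)
  moreover have "(\<lambda>n. \<Sum>j<K. falling_prod j (1 - w) * (w + of_nat j - 1) / fact (Suc j) * of_nat (Suc n) powr (- (w + of_nat j)))
     sums (\<Sum>j<K. falling_prod j (1 - w) * (w + of_nat j - 1) / fact (Suc j) * zeta_series (w + of_nat j))"
    by (intro sums_sum sums_mult has_sum_imp_sums zeta_series_has_sum) (use w in auto)
  ultimately have 1: "(\<lambda>n. binomial_remainder K w (of_nat (Suc n))) sums
     (0 - 1 + (\<Sum>j<K. falling_prod j (1 - w) * (w + of_nat j - 1) / fact (Suc j) * zeta_series (w + of_nat j)))"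
    unfolding binomial_remainder_eq by (rule sums_add)
  have "(\<lambda>n. (norm w + 1 + K) ^ Suc K * exp (pi * (norm w + K)) * real (Suc n) powr (-(Re w + K))) summable_on UNIV"
    using w by (intro summable_on_cmult_right summable_on_Suc_powr) auto
  then have "(\<lambda>n. norm (binomial_remainder K w (of_nat (Suc n)))) summable_on UNIV"
  proof (rule summable_on_comparison_test)
    show "norm (binomial_remainder K w (of_nat (Suc n)))
        \<le> (norm w + 1 + K) ^ Suc K * exp (pi * (norm w + K)) * real (Suc n) powr (-(Re w + K))" for n
      using w by (intro norm_binomial_remainder_le) auto
  qed auto
  then have "(\<lambda>n. binomial_remainder K w (of_nat (Suc n))) sums binomial_remainder_sum K w"
    unfolding binomial_remainder_sum_def by (rule has_sum_imp_sums[OF has_sum_infsum[OF abs_summable_summable]])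
  with 1 have "binomial_remainder_sum K w = 0 - 1 + (\<Sum>j<K. falling_prod j (1 - w) * (w + of_nat j - 1) / fact (Suc j) * zeta_series (w + of_nat j))"
    by (rule sums_unique2[symmetric])
  moreover have "{..<K} = insert 0 {1..<K}" using K by auto
  ultimately show ?thesis
    by (simp add: falling_prod_def mult_ac)
qed

text \<open>Each step widens the half plane by one: the recursion of order \<open>Suc K\<close>
  refers to \<open>w + j\<close> with \<open>j \<ge> 1\<close> only, and these points lie where the
  previous continuation is defined.\<close>

lemma zeta_series_continuation_halfplane:
  "\<exists>Z. Z holomorphic_on {w. Re w > 1 - real K} \<and> (\<forall>w. Re w > 1 \<longrightarrow> Z w = (w - 1) * zeta_series w)"
proof (induction K)
  case 0
  show ?case
    by (intro exI[of _ "\<lambda>w. (w - 1) * zeta_series w"]) (auto intro!: holomorphic_intros zeta_series_holomorphic)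
next
  case (Suc K)
  then obtain Z where Z: "Z holomorphic_on {w. Re w > 1 - real K}" "\<And>w. Re w > 1 \<Longrightarrow> Z w = (w - 1) * zeta_series w"
    by blast
  define Z' where "Z' = (\<lambda>w. 1 + binomial_remainder_sum (Suc K) w
           - (\<Sum>j=1..<Suc K. falling_prod j (1 - w) / fact (Suc j) * Z (w + of_nat j)))"
  have "(\<lambda>w. Z (w + of_nat j)) holomorphic_on {w. Re w > 1 - real (Suc K)}" if "j \<in> {1..<Suc K}" for j
    unfolding o_def[symmetric, of Z "\<lambda>w. w + of_nat j"]
    using that by (intro holomorphic_on_compose_gen[OF _ Z(1)] holomorphic_intros) auto
  then have "Z' holomorphic_on {w. Re w > 1 - real (Suc K)}"
    unfolding Z'_def by (intro holomorphic_intros binomial_remainder_sum_holomorphic) auto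
  moreover have "Z' w = (w - 1) * zeta_series w" if "Re w > 1" for w
    unfolding Z'_def using that zeta_series_recursion[OF that, of "Suc K"] by (simp add: Z(2))
  ultimately show ?case by blast
qed

lemma zeta_series_continuation:
  "\<exists>Z. Z holomorphic_on UNIV \<and> (\<forall>w. Re w > 1 \<longrightarrow> Z w = (w - 1) * zeta_series w)"
proof -
  obtain Z where hol: "\<And>K. Z K holomorphic_on {w. Re w > 1 - real K}"
    and eq: "\<And>K w. Re w > 1 \<Longrightarrow> Z K w = (w - 1) * zeta_series w"
    using zeta_series_continuation_halfplane by metis
  have agree: "Z K w = Z L w" if "K \<le> L" "Re w > 1 - real K" for K L w
  proof (rule analytic_continuation_open[of "{w. Re w > 1}" "{w. Re w > 1 - real K}" "Z K" "Z L"])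
    show "connected {w. Re w > 1 - real K}"
      by (intro convex_connected convex_halfspace_Re_gt)
    show "{w. 1 < Re w} \<noteq> {}" by (auto intro: exI[of _ 2])
    show "Z L holomorphic_on {w. Re w > 1 - real K}"
      using that by (intro holomorphic_on_subset[OF hol]) auto
  qed (use that hol eq in \<open>auto intro!: open_halfspace_Re_gt\<close>)
  \<comment> \<open>The continuations agree on common half planes, so any sufficiently large index
    gives the same value; the chosen one is at least \<open>2 - Re w\<close>, which puts
    \<open>w\<close> inside its half plane.\<close>
  define f where "f = (\<lambda>w. Z (nat \<lceil>2 - Re w\<rceil>) w)"
  have f: "f w = Z K w" if "Re w > 1 - real K" for K w
  proof -
    have "Re w > 1 - real (nat \<lceil>2 - Re w\<rceil>)" by linarith
    then show ?thesis
      unfolding f_def using agree[of K "nat \<lceil>2 - Re w\<rceil>" w] agree[of "nat \<lceil>2 - Re w\<rceil>" K w] that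
      by (cases "K \<le> nat \<lceil>2 - Re w\<rceil>") auto
  qed
  have "f holomorphic_on (\<Union>K. {w. Re w > 1 - real K})"
    by (intro holomorphic_on_UN_open holomorphic_transform[OF hol] open_halfspace_Re_gt) (use f in auto)
  moreover have "(\<Union>K. {w. Re w > 1 - real K}) = UNIV"
  proof -
    have "\<exists>K. Re w > 1 - real K" for w
      using reals_Archimedean2[of "1 - Re w"] by (auto simp: algebra_simps)
    then show ?thesis by auto
  qed
  ultimately show ?thesis
    using f[of 0] eq[of _ 0] by (intro exI[of _ f]) auto
qed

text \<open>The choice in \<open>zeta\<close> yields information only once some function is known to
  meet the specification; \<open>Z w / (w - 1)\<close> does, with \<open>Z\<close> the entire
  continuation.\<close>

lemma zeta_holomorphic: "zeta holomorphic_on - {1}"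
  and zeta_eq_zeta_series: "Re s > 1 \<Longrightarrow> zeta s = zeta_series s"
proof -
  obtain Z where Z: "Z holomorphic_on UNIV" "\<And>w. Re w > 1 \<Longrightarrow> Z w = (w - 1) * zeta_series w"
    using zeta_series_continuation by blast
  have sums: "(\<lambda>n. 1 / of_nat (Suc n) powr s) sums zeta_series s" if "Re s > 1" for s
    using has_sum_imp_sums[OF zeta_series_has_sum[OF that]] by (simp add: powr_minus_divide del: of_nat_Suc)
  have "\<exists>f. f holomorphic_on - {1} \<and> (\<forall>s. Re s > 1 \<longrightarrow> (\<lambda>n. 1 / of_nat (Suc n) powr s) sums f s)"
  proof (intro exI[of _ "\<lambda>w. Z w / (w - 1)"] conjI allI impI)
    show "(\<lambda>w. Z w / (w - 1)) holomorphic_on - {1}"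
      by (intro holomorphic_intros holomorphic_on_subset[OF Z(1)]) auto
    show "(\<lambda>n. 1 / of_nat (Suc n) powr s) sums (Z s / (s - 1))" if "Re s > 1" for s
      using sums[OF that] Z(2)[OF that] that by (cases "s = 1") auto
  qed
  then have *: "zeta holomorphic_on - {1} \<and> (\<forall>s. Re s > 1 \<longrightarrow> (\<lambda>n. 1 / of_nat (Suc n) powr s) sums zeta s)"
    unfolding zeta_def by (rule someI_ex)
  then show "zeta holomorphic_on - {1}" by blast
  show "zeta s = zeta_series s" if "Re s > 1"
    using * sums[OF that] that sums_unique2 by blast
qed

text \<open>The value 1 is the residue of \<zeta>, so that it fills the removable singularity of
  \<open>(w - 1) * zeta w\<close>.\<close>

definition zeta_regular :: "complex \<Rightarrow> complex" where
  "zeta_regular w = (if w = 1 then 1 else (w - 1) * zeta w)"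

lemma zeta_regular_eq_zeta_series: "Re w > 1 \<Longrightarrow> zeta_regular w = (w - 1) * zeta_series w"
  by (auto simp: zeta_regular_def zeta_eq_zeta_series)

text \<open>The recursion of order 2 extends to \<open>Re w > -1\<close>, and its remainder vanishes
  at \<open>w = 1\<close> and \<open>w = 0\<close>. It thus gives \<open>Z 1 = 1\<close>, the
  residue, and then \<open>Z 0 = 1 - Z 1 / 2\<close>.\<close>

lemma zeta_regular_holomorphic: "zeta_regular holomorphic_on A"
  and zeta_regular_0: "zeta_regular 0 = 1 / 2"
proof -
  obtain Z where Z: "Z holomorphic_on UNIV" "\<And>w. Re w > 1 \<Longrightarrow> Z w = (w - 1) * zeta_series w"
    using zeta_series_continuation by blast
  have ne: "{w. 1 < Re w} \<noteq> {}" by (auto intro: exI[of _ 2])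
  have rec: "Z w = 1 + binomial_remainder_sum 2 w - (1 - w) / 2 * Z (w + 1)" if "Re w > -1" for w
  proof (rule analytic_continuation_open[of "{w. Re w > 1}" "{w. Re w > -1}" Z])
    have "(\<lambda>w. Z (w + 1)) holomorphic_on {w. Re w > -1}"
      unfolding o_def[symmetric, of Z "\<lambda>w. w + 1"]
      by (intro holomorphic_on_compose_gen[OF _ Z(1)] holomorphic_intros) auto
    then show "(\<lambda>w. 1 + binomial_remainder_sum 2 w - (1 - w) / 2 * Z (w + 1)) holomorphic_on {w. Re w > -1}"
      using binomial_remainder_sum_holomorphic[of 2] by (intro holomorphic_intros) auto
    show "Z w = 1 + binomial_remainder_sum 2 w - (1 - w) / 2 * Z (w + 1)" if "w \<in> {w. Re w > 1}" for w
      using zeta_series_recursion[of w 2] that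
      by (simp add: Z(2) falling_prod_def) (simp add: numeral_2_eq_2)
    show "connected {w. Re w > -1}" by (intro convex_connected convex_halfspace_Re_gt)
  qed (use that ne Z in \<open>auto intro!: open_halfspace_Re_gt intro: holomorphic_on_subset\<close>)
  \<comment> \<open>The exponent \<open>1 - w\<close> is 0 or 1 here, so the binomial expansion is
    exact.\<close>
  have "binomial_remainder 2 1 z = 0" "binomial_remainder 2 0 z = 0" if "z \<noteq> 0" "z + 1 \<noteq> 0" for z
    using that by (simp_all add: binomial_remainder_def falling_prod_def eval_nat_numeral)
  then have "binomial_remainder 2 1 (of_nat (Suc n)) = 0" "binomial_remainder 2 0 (of_nat (Suc n)) = 0" for n
    by (simp_all add: complex_eq_iff)
  then have "binomial_remainder_sum 2 1 = 0" "binomial_remainder_sum 2 0 = 0"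
    by (simp_all add: binomial_remainder_sum_def)
  then have Z1: "Z 1 = 1" and Z0: "Z 0 = 1 / 2"
    using rec[of 1] rec[of 0] by simp_all
  have "(w - 1) * zeta w = Z w" if "w \<in> - {1}" for w
  proof (rule analytic_continuation_open[of "{w. Re w > 1}" "- {1}" _ Z])
    have "connected (UNIV - {1::complex})"
      by (intro connected_open_delete) auto
    then show "connected (- {1::complex})" by (simp add: Compl_eq_Diff_UNIV)
    show "(\<lambda>w. (w - 1) * zeta w) holomorphic_on - {1}"
      by (intro holomorphic_intros zeta_holomorphic)
  qed (use that ne Z zeta_eq_zeta_series in \<open>auto intro!: open_halfspace_Re_gt intro: holomorphic_on_subset\<close>)
  then have "zeta_regular = Z" by (auto simp: zeta_regular_def Z1)
  then show "zeta_regular holomorphic_on A" "zeta_regular 0 = 1 / 2"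
    using Z(1) Z0 holomorphic_on_subset by auto
qed

text \<open>Multiplication by \<open>w - 1\<close> moves the Laurent coefficient of index
  \<open>m\<close> to the Taylor index \<open>m + 1\<close>, and \<open>m! / (m + 1)!\<close> leaves
  the denominator \<open>Suc m\<close>.\<close>

lemma stieltjes_eq: "stieltjes m = (-1) ^ m * (deriv ^^ Suc m) zeta_regular 1 / of_nat (Suc m)"
proof -
  let ?F = "fps_to_fls (fps_expansion zeta_regular 1)"
  have "(\<lambda>x. zeta_regular (1 + x)) has_laurent_expansion ?F"
    by (intro has_laurent_expansion_fps analytic_at_imp_has_fps_expansion)
       (use zeta_regular_holomorphic[of UNIV] in \<open>auto simp: analytic_at intro!: exI[of _ UNIV]\<close>)
  then have "(\<lambda>x. x powi (-1) * zeta_regular (1 + x)) has_laurent_expansion fls_X_intpow (-1) * ?F"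
    by (intro laurent_expansion_intros)
  also have "?this \<longleftrightarrow> (\<lambda>x. zeta (1 + x)) has_laurent_expansion fls_shift 1 ?F"
  proof (rule has_laurent_expansion_cong)
    show "eventually (\<lambda>x. x powi (-1) * zeta_regular (1 + x) = zeta (1 + x)) (at 0)"
      by (auto simp: eventually_at_filter zeta_regular_def power_int_minus)
  qed (simp add: fls_shifted_times_simps)
  finally have "laurent_expansion zeta 1 = fls_shift 1 ?F"
    by (rule laurent_expansion_eqI)
  moreover have "nat (int m + 1) = Suc m" by simp
  ultimately show ?thesis
    by (simp add: stieltjes_def fps_expansion_def add.commute del: funpow.simps of_nat_Suc)
qed

subsection \<open>Lattice sums\<close>

text \<open>The geometric mean is dominated by positive linear forms, and its powers factor in
  \<open>m\<close> and \<open>n\<close>, so that summability over pairs reduces to single series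
  without loss in the exponent.\<close>

definition lat_gauge :: "nat \<times> nat \<Rightarrow> real" where
  "lat_gauge = (\<lambda>(m, n). sqrt (real (Suc m) * real (Suc n)))"

lemma lat_gauge_ge_1: "1 \<le> lat_gauge p"
proof -
  have "1 * 1 \<le> real (Suc (fst p)) * real (Suc (snd p))"
    by (intro mult_mono) auto
  then show ?thesis by (simp add: lat_gauge_def case_prod_unfold)
qed

lemma summable_on_lat_gauge:
  assumes "\<sigma> > 2"
  shows "(\<lambda>p. lat_gauge p powr (-\<sigma>)) summable_on UNIV"
proof -
  define h where "h = (\<lambda>n. real (Suc n) powr (-(\<sigma> / 2)))"
  have h: "h summable_on UNIV"
    unfolding h_def using assms by (intro summable_on_Suc_powr) auto
  have eq: "lat_gauge (m, n) powr (-\<sigma>) = h m * h n" for m n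
    by (simp add: lat_gauge_def h_def powr_half_sqrt[symmetric] powr_powr powr_mult)
  have "(\<lambda>(m, n). h m * h n) summable_on UNIV \<times> UNIV"
  proof (rule summable_on_SigmaI)
    show "((\<lambda>n. case (m, n) of (m, n) \<Rightarrow> h m * h n) has_sum h m * infsum h UNIV) UNIV" for m
      using has_sum_cmult_right[OF has_sum_infsum[OF h]] by simp
    show "(\<lambda>m. h m * infsum h UNIV) summable_on UNIV"
      by (intro summable_on_cmult_left h)
  qed (auto simp: h_def)
  then show ?thesis
    by (simp add: eq case_prod_unfold flip: eq)
qed

text \<open>Arithmetic-geometric mean inequality; away from the origin
  \<open>(m + n + 2) / 2 \<le> 2 * (m + n)\<close>, whence the factor 1/2. The minimum with 1 makes
  the constant fit for \<open>norm_powr_uminus_le\<close>.\<close>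

lemma lat_gauge_le:
  assumes "\<alpha> > 0" "\<beta> > 0" "(m, n) \<noteq> (0, 0)"
  shows "min 1 (min \<alpha> \<beta>) / 2 * lat_gauge (m, n) \<le> real m * \<alpha> + real n * \<beta>"
proof -
  define c where "c = min 1 (min \<alpha> \<beta>)"
  have c: "c > 0" "c \<le> \<alpha>" "c \<le> \<beta>" using assms by (auto simp: c_def)
  have "lat_gauge (m, n) \<le> (real (Suc m) + real (Suc n)) / 2"
    unfolding lat_gauge_def prod.case by (rule arith_geo_mean_sqrt) auto
  moreover have "m + n \<ge> 1" using assms by auto
  then have "real (m + n) \<ge> 1" by linarith
  ultimately have "lat_gauge (m, n) \<le> 2 * (real m + real n)" by simp
  then have "c / 2 * lat_gauge (m, n) \<le> c / 2 * (2 * (real m + real n))"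
    using c by (intro mult_left_mono) auto
  also have "\<dots> = real m * c + real n * c" by (simp add: algebra_simps)
  also have "\<dots> \<le> real m * \<alpha> + real n * \<beta>"
    using c by (intro add_mono mult_left_mono) auto
  finally show ?thesis by (simp add: c_def)
qed

section \<open>Sums along one column and over the whole quadrant\<close>

definition hurwitz_series :: "complex \<Rightarrow> real \<Rightarrow> complex" where
  "hurwitz_series s y = (\<Sum>\<^sub>\<infinity>n. of_real (y + real n) powr (-s))"

lemma hurwitz_series_has_sum:
  assumes "y > 0" "Re s > 1"
  shows "((\<lambda>n. of_real (y + real n) powr (-s)) has_sum hurwitz_series s y) UNIV"
  unfolding hurwitz_series_def
proof (rule has_sum_infsum[OF abs_summable_summable], rule Infinite_Sum.abs_summable_on_comparison_test')
  define c where "c = min 1 y"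
  show "(\<lambda>n. exp (pi * norm s) * c powr (- norm s) * real (Suc n) powr (- Re s)) summable_on UNIV"
    using assms by (intro summable_on_cmult_right summable_on_Suc_powr)
  show "norm (of_real (y + real n) powr (-s)) \<le> exp (pi * norm s) * c powr (- norm s) * real (Suc n) powr (- Re s)" for n
  proof (rule norm_powr_uminus_le)
    have "c * real (Suc n) = c + c * real n" by (simp add: algebra_simps)
    also have "\<dots> \<le> y + 1 * real n"
      unfolding c_def by (intro add_mono mult_right_mono) auto
    finally show "c * real (Suc n) \<le> norm (of_real (y + real n) :: complex)"
      using assms by (simp del: of_real_add)
  qed (use assms in \<open>auto simp: c_def\<close>)
qed

lemma has_sum_diff:
  fixes f g :: "'i \<Rightarrow> 'a :: topological_ab_group_add"
  assumes "(f has_sum S) A" "(g has_sum T) A"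
  shows "((\<lambda>x. f x - g x) has_sum S - T) A"
  using has_sum_add[OF assms(1), of "\<lambda>x. - g x" "- T"] assms(2) by (simp add: has_sum_uminus)

lemma has_sum_Suc_shift:
  fixes f :: "nat \<Rightarrow> 'a :: {topological_ab_group_add, t2_space}"
  assumes "(f has_sum S) UNIV"
  shows "((\<lambda>n. f (Suc n)) has_sum S - f 0) UNIV"
proof -
  have "(f has_sum S - f 0) (UNIV - {0})"
    using has_sum_Diff[OF assms, of "{0}" "f 0"] by (simp add: has_sum_finite_iff)
  also have "UNIV - {0::nat} = range Suc"
    using not0_implies_Suc by auto
  finally show ?thesis
    by (simp add: has_sum_reindex o_def)
qed

text \<open>For \<open>Re w > 2\<close> the primitives \<open>(y + n) powr (1 - w)\<close> are
  summable too, so each part is a series combined with its own shift. The half term lost at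
  \<open>n = 0\<close> is the boundary weight.\<close>

lemma trapezoid_defect_has_sum:
  assumes y: "y > 0" and w: "Re w > 2"
  shows "((\<lambda>n. trapezoid_defect w (of_real (y + real n))) has_sum
     (w - 1) * (hurwitz_series w y - of_real y powr (-w) / 2) - of_real y powr (1 - w)) UNIV"
proof -
  have 1: "((\<lambda>n. of_real (y + real n) powr (-w)) has_sum hurwitz_series w y) UNIV"
    using assms by (intro hurwitz_series_has_sum) auto
  have 2: "((\<lambda>n. of_real (y + real n) powr (1 - w)) has_sum hurwitz_series (w - 1) y) UNIV"
    using hurwitz_series_has_sum[of y "w - 1"] assms by simp
  have "((\<lambda>n. (w - 1) / 2 * (of_real (y + real n) powr (-w) + of_real (y + real (Suc n)) powr (-w))
            + of_real (y + real (Suc n)) powr (1 - w) - of_real (y + real n) powr (1 - w))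
     has_sum (w - 1) / 2 * (hurwitz_series w y + (hurwitz_series w y - of_real (y + real 0) powr (-w)))
        + (hurwitz_series (w - 1) y - of_real (y + real 0) powr (1 - w)) - hurwitz_series (w - 1) y) UNIV"
    by (intro has_sum_diff has_sum_add has_sum_cmult_right 1 2
          has_sum_Suc_shift[of "\<lambda>n. of_real (y + real n) powr (-w)"]
          has_sum_Suc_shift[of "\<lambda>n. of_real (y + real n) powr (1 - w)"])
  then show ?thesis
    by (simp add: trapezoid_defect_def algebra_simps add_divide_distrib diff_divide_distrib)
qed

text \<open>
  The product weight \<open>1/4\<close> at the origin is harmless in the sums below, because \<open>0 powr (-w) = 0\<close>.
\<close>
definition half_wt :: "nat \<Rightarrow> complex" where
  "half_wt n = (if n = 0 then 1 / 2 else 1)"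

definition lat_sum :: "complex \<Rightarrow> real \<Rightarrow> real \<Rightarrow> complex" where
  "lat_sum w \<alpha> \<beta> = (\<Sum>\<^sub>\<infinity>(m, n). half_wt m * half_wt n * of_real (real m * \<alpha> + real n * \<beta>) powr (-w))"

lemma lat_sum_has_sum:
  assumes "\<alpha> > 0" "\<beta> > 0" "Re w > 2"
  shows "((\<lambda>(m, n). half_wt m * half_wt n * of_real (real m * \<alpha> + real n * \<beta>) powr (-w))
           has_sum lat_sum w \<alpha> \<beta>) UNIV"
  unfolding lat_sum_def
proof (rule has_sum_infsum[OF abs_summable_summable], rule Infinite_Sum.abs_summable_on_comparison_test')
  define c where "c = min 1 (min \<alpha> \<beta>) / 2"
  define C where "C = exp (pi * norm w) * c powr (- norm w)"
  have c: "0 < c" "c \<le> 1" using assms by (auto simp: c_def)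
  show "(\<lambda>p. C * lat_gauge p powr (- Re w)) summable_on UNIV"
    using assms by (intro summable_on_cmult_right summable_on_lat_gauge)
  fix p :: "nat \<times> nat"
  obtain m n where p: "p = (m, n)" by fastforce
  show "norm (case p of (m, n) \<Rightarrow> half_wt m * half_wt n * of_real (real m * \<alpha> + real n * \<beta>) powr (-w))
      \<le> C * lat_gauge p powr (- Re w)"
  proof (cases "p = (0, 0)")
    case True
    then show ?thesis by (simp add: C_def)
  next
    case False
    have "norm (of_real (real m * \<alpha> + real n * \<beta>) powr (-w) :: complex) \<le> C * lat_gauge p powr (- Re w)"
      unfolding C_def
    proof (rule norm_powr_uminus_le)
      have "c * lat_gauge p \<le> real m * \<alpha> + real n * \<beta>"
        unfolding p c_def using assms False p by (intro lat_gauge_le) auto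
      then show "c * lat_gauge p \<le> norm (of_real (real m * \<alpha> + real n * \<beta>) :: complex)"
        unfolding norm_of_real by linarith
    qed (use assms c lat_gauge_ge_1 in auto)
    moreover have "norm (half_wt m * half_wt n) \<le> 1"
      by (simp add: half_wt_def norm_mult)
    ultimately have "norm (half_wt m * half_wt n) * norm (of_real (real m * \<alpha> + real n * \<beta>) powr (-w) :: complex)
       \<le> 1 * (C * lat_gauge p powr (- Re w))"
      by (intro mult_mono) auto
    then show ?thesis by (simp add: p norm_mult del: of_real_add)
  qed
qed

lemma lat_sum_scale:
  assumes "c > 0" "\<alpha> > 0" "\<beta> > 0"
  shows "lat_sum w (c * \<alpha>) (c * \<beta>) = of_real c powr (-w) * lat_sum w \<alpha> \<beta>"
proof -
  have "of_real (real m * (c * \<alpha>) + real n * (c * \<beta>)) powr (-w)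
      = (of_real c powr (-w) * of_real (real m * \<alpha> + real n * \<beta>) powr (-w) :: complex)" for m n
  proof -
    have "(of_real (real m * (c * \<alpha>) + real n * (c * \<beta>)) :: complex)
        = of_real c * of_real (real m * \<alpha> + real n * \<beta>)"
      by (simp add: algebra_simps)
    moreover have "0 \<le> real m * \<alpha> + real n * \<beta>" using assms by simp
    ultimately show ?thesis
      using assms by (simp only: powr_times_real_left Reals_of_real Re_complex_of_real less_imp_le)
  qed
  then have "(\<lambda>(m, n). half_wt m * half_wt n * of_real (real m * (c * \<alpha>) + real n * (c * \<beta>)) powr (-w))
    = (\<lambda>p. of_real c powr (-w) * (case p of (m, n) \<Rightarrow>
         half_wt m * half_wt n * of_real (real m * \<alpha> + real n * \<beta>) powr (-w)))"
    by (auto simp: fun_eq_iff)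
  then show ?thesis
    unfolding lat_sum_def by (simp add: infsum_cmult_right')
qed

text \<open>The column \<open>m = 0\<close> is left out: there the rule would start at the singular
  point 0. Its contribution is a multiple of \<zeta> and enters \<open>eisen_period\<close>
  separately.\<close>

definition trapezoid_defect_sum :: "complex \<Rightarrow> real \<Rightarrow> complex" where
  "trapezoid_defect_sum w x = (\<Sum>\<^sub>\<infinity>(m, n). trapezoid_defect w (of_real (real (Suc m) * x + real n)))"

text \<open>The gain of two powers makes the majorant a power of \<open>lat_gauge\<close> with
  exponent \<open>-(\<sigma> + 2)\<close>, summable exactly in the range \<sigma> > 0.\<close>

lemma
  assumes x: "x > 0"
  shows trapezoid_defect_sum_holomorphic: "(\<lambda>w. trapezoid_defect_sum w x) holomorphic_on {w. Re w > 0}"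
    and trapezoid_defect_sum_deriv_has_sum: "Re z > 0 \<Longrightarrow>
      ((\<lambda>(m, n). (deriv ^^ k) (\<lambda>w. trapezoid_defect w (of_real (real (Suc m) * x + real n)))  z) has_sum
         (deriv ^^ k) (\<lambda>w. trapezoid_defect_sum w x) z) UNIV"
proof -
  define f where "f = (\<lambda>(m, n) w. trapezoid_defect w (of_real (real (Suc m) * x + real n)))"
  define c where "c = min 1 x / 2"
  have c: "0 < c" "c \<le> 1" using x by (auto simp: c_def)
  have holo: "f p holomorphic_on A" for p A
    unfolding f_def trapezoid_defect_def case_prod_unfold by (intro holomorphic_intros) auto
  have dom: "\<exists>M. M summable_on UNIV \<and>
      (\<forall>p\<in>UNIV. \<forall>w. \<sigma> \<le> Re w \<longrightarrow> norm w \<le> B \<longrightarrow> norm (f p w) \<le> M p)" if "\<sigma> > 0" for \<sigma> B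
  proof (intro exI conjI ballI allI impI)
    let ?C = "(B + 1) ^ 3 * exp (pi * (B + 2)) * c powr (-(B + 2))"
    show "(\<lambda>p. ?C * lat_gauge p powr (-(\<sigma> + 2))) summable_on UNIV"
      using that by (intro summable_on_cmult_right summable_on_lat_gauge) auto
    fix p :: "nat \<times> nat" and w assume w: "\<sigma> \<le> Re w" "norm w \<le> B"
    obtain m n where p: "p = (m, n)" by fastforce
    have "norm (trapezoid_defect w (of_real (real (Suc m) * x + real n))) \<le> ?C * lat_gauge p powr (-(\<sigma> + 2))"
    proof (rule norm_trapezoid_defect_le)
      \<comment> \<open>The pair \<open>(Suc m, n)\<close> is never the origin, as
        \<open>lat_gauge_le\<close> demands.\<close>
      have "c * lat_gauge p \<le> c * lat_gauge (Suc m, n)"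
        unfolding p lat_gauge_def using c by (intro mult_left_mono) auto
      also have "\<dots> \<le> real (Suc m) * x + real n * 1"
        unfolding c_def using lat_gauge_le[of x 1 "Suc m" n] x by (simp add: min.commute)
      finally have le: "c * lat_gauge p \<le> real (Suc m) * x + real n" by simp
      then show "c * lat_gauge p \<le> norm (of_real (real (Suc m) * x + real n) :: complex)"
        unfolding norm_of_real by linarith
      show "0 < Re (of_real (real (Suc m) * x + real n))"
        using x by (simp add: add_pos_nonneg)
    qed (use that w c lat_gauge_ge_1 in auto)
    then show "norm (f p w) \<le> ?C * lat_gauge p powr (-(\<sigma> + 2))"
      by (simp add: f_def p)
  qed
  have eq: "(\<lambda>w. trapezoid_defect_sum w x) = (\<lambda>w. \<Sum>\<^sub>\<infinity>p. f p w)"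
    by (simp add: trapezoid_defect_sum_def f_def case_prod_unfold)
  show "(\<lambda>w. trapezoid_defect_sum w x) holomorphic_on {w. Re w > 0}"
    unfolding eq using holo dom by (rule holomorphic_on_infsum_halfplane)
  show "((\<lambda>(m, n). (deriv ^^ k) (\<lambda>w. trapezoid_defect w (of_real (real (Suc m) * x + real n)))  z) has_sum
         (deriv ^^ k) (\<lambda>w. trapezoid_defect_sum w x) z) UNIV" if "Re z > 0"
    using has_sum_higher_deriv_halfplane[OF holo dom that, where k = k]
    unfolding eq by (simp add: f_def case_prod_unfold)
qed

section \<open>The continued lattice sum\<close>

text \<open>This continues \<open>(w - 1) * lat_sum w x 1\<close>. The summands are the trapezoidal
  errors in the columns \<open>m \<ge> 1\<close>, the integrals along these columns, and the column
  \<open>m = 0\<close> with its weight 1/2.\<close>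

definition eisen_period :: "real \<Rightarrow> complex \<Rightarrow> complex" where
  "eisen_period x w = trapezoid_defect_sum w x + of_real x powr (1 - w) * zeta (w - 1) + zeta_regular w / 2"

lemma eisen_period_holomorphic:
  assumes "x > 0"
  shows "eisen_period x holomorphic_on {w. Re w > 0} - {2}"
proof -
  have "(\<lambda>w. zeta (w - 1)) holomorphic_on {w. Re w > 0} - {2}"
    unfolding o_def[symmetric, of zeta "\<lambda>w. w - 1"]
    by (intro holomorphic_on_compose_gen[OF _ zeta_holomorphic] holomorphic_intros)
       (auto simp: algebra_simps)
  then show ?thesis
    unfolding eisen_period_def using assms
    by (intro holomorphic_intros zeta_regular_holomorphic holomorphic_on_subset[OF trapezoid_defect_sum_holomorphic]) auto
qed

text \<open>Both double sums are evaluated column by column. Along a column \<open>m \<ge> 1\<close>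
  the defects add up to \<open>w - 1\<close> times the weighted sum minus the integral term
  \<open>(m * x) powr (1 - w)\<close>, and the latter sum over \<open>m\<close> to the value of
  \<zeta> at \<open>w - 1\<close>.\<close>

lemma eisen_period_eq_lat_sum:
  assumes x: "x > 0" and w: "Re w > 2"
  shows "eisen_period x w = (w - 1) * lat_sum w x 1"
proof -
  \<comment> \<open>\<open>g m\<close> is the sum along column \<open>m\<close>, boundary weights
    included.\<close>
  define g where "g = (\<lambda>m. if m = 0 then zeta_series w / 2
      else hurwitz_series w (real m * x) - of_real (real m * x) powr (-w) / 2)"
  have "(g has_sum lat_sum w x 1) UNIV"
  proof (rule has_sum_SigmaD)
    show "((\<lambda>(m, n). half_wt m * half_wt n * of_real (real m * x + real n * 1) powr (-w))
           has_sum lat_sum w x 1) (UNIV \<times> UNIV)"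
      using lat_sum_has_sum[of x 1 w] assms by simp
    show "((\<lambda>n. case (m, n) of (m, n) \<Rightarrow> half_wt m * half_wt n *
            of_real (real m * x + real n * 1) powr (-w)) has_sum g m) UNIV" for m
    proof (cases "m = 0")
      case True
      have "((\<lambda>n. of_nat (Suc n) powr (-w)) has_sum zeta_series w) UNIV"
        using w by (intro zeta_series_has_sum) auto
      then have "((\<lambda>n. of_nat n powr (-w)) has_sum zeta_series w) (range Suc)"
        by (simp add: has_sum_reindex o_def)
      then have "((\<lambda>n. 1 / 2 * of_nat n powr (-w)) has_sum 1 / 2 * zeta_series w) (range Suc)"
        by (rule has_sum_cmult_right)
      also have "?this \<longleftrightarrow> ((\<lambda>n. 1 / 2 * half_wt n * of_nat n powr (-w)) has_sum 1 / 2 * zeta_series w) UNIV"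
        by (rule has_sum_cong_neutral) (auto simp: half_wt_def image_iff dest: not0_implies_Suc)
      finally show ?thesis using True by (simp add: g_def half_wt_def)
    next
      case False
      then have "real m * x > 0" using x by simp
      then have "((\<lambda>n. of_real (real m * x + real n) powr (-w)) has_sum hurwitz_series w (real m * x)) UNIV"
        using w by (intro hurwitz_series_has_sum) auto
      \<comment> \<open>Subtracting half of the entry at \<open>n = 0\<close> turns the plain
        Hurwitz series into the weighted one.\<close>
      moreover have "((\<lambda>n. if n = 0 then of_real (real m * x) powr (-w) / 2 else 0) has_sum
          of_real (real m * x) powr (-w) / 2) {0::nat}"
        by (simp add: has_sum_finite_iff)
      then have "((\<lambda>n. if n = 0 then of_real (real m * x) powr (-w) / 2 else 0) has_sum
          of_real (real m * x) powr (-w) / 2) (UNIV :: nat set)"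
        by (subst (asm) has_sum_cong_neutral[where T = UNIV]) auto
      ultimately have "((\<lambda>n. of_real (real m * x + real n) powr (-w)
          - (if n = 0 then of_real (real m * x) powr (-w) / 2 else 0)) has_sum g m) UNIV"
        unfolding g_def using False by (auto intro: has_sum_diff)
      also have "?this \<longleftrightarrow> ?thesis"
        using False by (intro has_sum_cong) (auto simp: half_wt_def)
      finally show ?thesis .
    qed
  qed
  then have g: "((\<lambda>m. g (Suc m)) has_sum lat_sum w x 1 - zeta_series w / 2) UNIV"
    using has_sum_Suc_shift[of g] by (simp add: g_def)
  have z: "((\<lambda>m. of_real (real (Suc m) * x) powr (1 - w)) has_sum of_real x powr (1 - w) * zeta_series (w - 1)) UNIV"
  proof -
    have "((\<lambda>m. of_nat (Suc m) powr (- (w - 1))) has_sum zeta_series (w - 1)) UNIV"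
      using w by (intro zeta_series_has_sum) auto
    then have "((\<lambda>m. of_real x powr (1 - w) * of_nat (Suc m) powr (1 - w)) has_sum of_real x powr (1 - w) * zeta_series (w - 1)) UNIV"
      by (intro has_sum_cmult_right) (simp del: of_nat_Suc)
    moreover have "of_real x powr (1 - w) * of_nat (Suc m) powr (1 - w)
       = of_real (real (Suc m) * x) powr (1 - w)" for m
      using powr_times_real_left[of "of_real x" "of_nat (Suc m)" "1 - w"] x
      by (simp add: mult.commute del: of_nat_Suc)
    ultimately show ?thesis by (simp only:)
  qed
  have "((\<lambda>m. (w - 1) * g (Suc m) - of_real (real (Suc m) * x) powr (1 - w)) has_sum trapezoid_defect_sum w x) UNIV"
  proof (rule has_sum_SigmaD)
    show "((\<lambda>(m, n). trapezoid_defect w (of_real (real (Suc m) * x + real n))) has_sum trapezoid_defect_sum w x) (UNIV \<times> UNIV)"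
      using trapezoid_defect_sum_deriv_has_sum[OF x, of w 0] w by (simp del: of_nat_Suc)
    show "((\<lambda>n. case (m, n) of (m, n) \<Rightarrow> trapezoid_defect w (of_real (real (Suc m) * x + real n))) has_sum
           (w - 1) * g (Suc m) - of_real (real (Suc m) * x) powr (1 - w)) UNIV" for m
      using trapezoid_defect_has_sum[of "real (Suc m) * x" w] w x by (simp add: g_def del: of_nat_Suc)
  qed
  moreover have "((\<lambda>m. (w - 1) * g (Suc m) - of_real (real (Suc m) * x) powr (1 - w)) has_sum
      (w - 1) * (lat_sum w x 1 - zeta_series w / 2) - of_real x powr (1 - w) * zeta_series (w - 1)) UNIV"
    by (intro has_sum_diff has_sum_cmult_right g z)
  ultimately have "trapezoid_defect_sum w x = (w - 1) * (lat_sum w x 1 - zeta_series w / 2) - of_real x powr (1 - w) * zeta_series (w - 1)"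
    by (rule has_sum_unique)
  then show ?thesis
    using w by (simp add: eisen_period_def zeta_eq_zeta_series zeta_regular_eq_zeta_series algebra_simps)
qed

text \<open>This settles the derivative of order 0 in \<open>eisen_period_deriv\<close>, so that no
  undifferentiated term survives in the Leibniz rule.\<close>

lemma eisen_period_1:
  assumes "x > 0"
  shows "eisen_period x 1 = 0"
proof -
  have "trapezoid_defect 1 z = 0" if "z \<noteq> 0" "z + 1 \<noteq> 0" for z
    using that by (simp add: trapezoid_defect_def)
  moreover have "of_real (real (Suc m) * x + real n) + 1 \<noteq> (0::complex)"
    "of_real (real (Suc m) * x + real n) \<noteq> (0::complex)" for m n
  proof -
    have "real (Suc m) * x + real n > 0" using assms by (simp add: add_pos_nonneg)
    then show "of_real (real (Suc m) * x + real n) + 1 \<noteq> (0::complex)"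
      "of_real (real (Suc m) * x + real n) \<noteq> (0::complex)"
      by (auto simp only: complex_eq_iff plus_complex.sel Re_complex_of_real one_complex.sel zero_complex.sel)
  qed
  ultimately have "trapezoid_defect_sum 1 x = 0"
    by (simp add: trapezoid_defect_sum_def case_prod_unfold del: of_nat_Suc of_real_add)
  moreover have "zeta 0 = - (1 / 2)"
    using zeta_regular_0 by (metis (no_types) diff_0 minus_minus mult_minus1 zero_neq_one zeta_regular_def)
  ultimately show ?thesis
    using assms by (simp add: eisen_period_def zeta_regular_def)
qed

subsection \<open>The generalized digamma function\<close>

text \<open>Up to the sign \<open>(-1) ^ K\<close>, the derivative of order \<open>K\<close> of
  \<open>z powr (-w)\<close> in \<open>w\<close> at \<open>w = 1\<close>.\<close>

definition log_quot :: "nat \<Rightarrow> complex \<Rightarrow> complex" where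
  "log_quot K z = Ln z ^ K / z"

definition log_prim :: "nat \<Rightarrow> complex \<Rightarrow> complex" where
  "log_prim K z = Ln z ^ Suc K / of_nat (Suc K)"

text \<open>The error of the trapezoidal rule for \<open>log_quot K\<close> on
  \<open>[z, z + 1]\<close>, with \<open>log_prim K\<close> as primitive.\<close>

definition log_defect :: "nat \<Rightarrow> complex \<Rightarrow> complex" where
  "log_defect K z = (log_quot K z + log_quot K (z + 1)) / 2 - (log_prim K (z + 1) - log_prim K z)"

lemma higher_deriv_powr_diff:
  fixes c a :: complex
  assumes "c \<noteq> 0"
  shows "(deriv ^^ k) (\<lambda>w. c powr (a - w)) = (\<lambda>w. (- Ln c) ^ k * c powr (a - w))"
proof (induction k)
  case (Suc k)
  have "((\<lambda>w. (- Ln c) ^ k * c powr (a - w)) has_field_derivative (- Ln c) ^ Suc k * c powr (a - w)) (at w)" for w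
    using assms unfolding powr_def by (auto intro!: derivative_eq_intros)
  then have "deriv (\<lambda>w. (- Ln c) ^ k * c powr (a - w)) = (\<lambda>w. (- Ln c) ^ Suc k * c powr (a - w))"
    by (intro ext DERIV_imp_deriv)
  then show ?case by (simp only: funpow.simps o_apply Suc)
qed simp

lemma higher_deriv_times_powr:
  fixes c :: complex
  assumes "c \<noteq> 0"
  shows "(deriv ^^ k) (\<lambda>w. (w - 1) / 2 * c powr (- w))
    = (\<lambda>w. (w - 1) / 2 * ((- Ln c) ^ k * c powr (- w)) + of_nat k / 2 * ((- Ln c) ^ (k - 1) * c powr (- w)))"
proof (induction k)
  case (Suc k)
  \<comment> \<open>For \<open>k = 0\<close> the truncated \<open>k - 1\<close> does no damage,
    since the factor \<open>of_nat k\<close> is zero.\<close>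
  have k: "of_nat k * ((- Ln c) ^ (k - 1) * (- Ln c)) = of_nat k * (- Ln c) ^ k"
    by (cases k) auto
  define g where "g = (\<lambda>w. c powr (- w))"
  have g: "(g has_field_derivative (- Ln c) * g w) (at w)" for w
    using assms unfolding g_def powr_def by (auto intro!: derivative_eq_intros)
  have "((\<lambda>w. (w - 1) / 2 * ((- Ln c) ^ k * g w) + of_nat k / 2 * ((- Ln c) ^ (k - 1) * g w))
      has_field_derivative ((w - 1) / 2 * ((- Ln c) ^ Suc k * g w) + of_nat (Suc k) / 2 * ((- Ln c) ^ k * g w))) (at w)" for w
  proof -
    have "((\<lambda>w. (w - 1) / 2 * ((- Ln c) ^ k * g w) + of_nat k / 2 * ((- Ln c) ^ (k - 1) * g w))
      has_field_derivative (1 / 2 * ((- Ln c) ^ k * g w) + (w - 1) / 2 * ((- Ln c) ^ k * ((- Ln c) * g w))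
         + of_nat k / 2 * ((- Ln c) ^ (k - 1) * ((- Ln c) * g w)))) (at w)"
      by (auto intro!: derivative_eq_intros g simp: mult_ac)
    also have "of_nat k / 2 * ((- Ln c) ^ (k - 1) * ((- Ln c) * g w)) = of_nat k / 2 * ((- Ln c) ^ k * g w)"
      using k by (metis (no_types, opaque_lifting) mult.assoc times_divide_eq_left)
    finally show ?thesis
      by (rule DERIV_cong) (simp add: algebra_simps add_divide_distrib)
  qed
  then have "deriv (\<lambda>w. (w - 1) / 2 * ((- Ln c) ^ k * g w) + of_nat k / 2 * ((- Ln c) ^ (k - 1) * g w))
      = (\<lambda>w. (w - 1) / 2 * ((- Ln c) ^ Suc k * g w) + of_nat (Suc k) / 2 * ((- Ln c) ^ (Suc k - 1) * g w))"
    by (intro ext DERIV_imp_deriv) simp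
  then show ?case unfolding g_def by (simp only: funpow.simps o_apply Suc)
qed simp

lemma trapezoid_defect_holomorphic [holomorphic_intros]:
  "f holomorphic_on A \<Longrightarrow> (\<lambda>w. trapezoid_defect (f w) z) holomorphic_on A"
  unfolding trapezoid_defect_def by (intro holomorphic_intros) auto

text \<open>At \<open>w = 1\<close> the factor \<open>w - 1\<close> leaves only the Leibniz term in
  which it is differentiated once, with coefficient \<open>Suc K\<close>. The primitives are
  differentiated one time more and supply the same coefficient through the denominator of
  \<open>log_prim\<close>.\<close>

lemma higher_deriv_trapezoid_defect:
  assumes "z \<noteq> 0" "z + 1 \<noteq> 0"
  shows "(deriv ^^ Suc K) (\<lambda>w. trapezoid_defect w z) 1 = of_nat (Suc K) * (-1) ^ K * log_defect K z"
proof -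
  have "(deriv ^^ Suc K) (\<lambda>w. trapezoid_defect w z) 1
     = (deriv ^^ Suc K) (\<lambda>w. ((w - 1) / 2 * z powr (- w) + (w - 1) / 2 * (z + 1) powr (- w))
           + ((z + 1) powr (1 - w) - z powr (1 - w))) 1"
    by (simp add: trapezoid_defect_def algebra_simps)
  also have "\<dots> = (deriv ^^ Suc K) (\<lambda>w. (w - 1) / 2 * z powr (- w)) 1
      + (deriv ^^ Suc K) (\<lambda>w. (w - 1) / 2 * (z + 1) powr (- w)) 1
      + ((deriv ^^ Suc K) (\<lambda>w. (z + 1) powr (1 - w)) 1 - (deriv ^^ Suc K) (\<lambda>w. z powr (1 - w)) 1)"
    by (simp only: higher_deriv_add[of _ UNIV] higher_deriv_diff[of _ UNIV] open_UNIV UNIV_I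
         holomorphic_intros)
  also have "\<dots> = of_nat (Suc K) / 2 * ((- Ln z) ^ K / z + (- Ln (z + 1)) ^ K / (z + 1))
      + ((- Ln (z + 1)) ^ Suc K - (- Ln z) ^ Suc K)"
    unfolding higher_deriv_times_powr[OF assms(1)] higher_deriv_times_powr[OF assms(2)]
      higher_deriv_powr_diff[OF assms(1)] higher_deriv_powr_diff[OF assms(2)]
    using assms by (simp add: powr_minus_divide add_divide_distrib distrib_left del: of_nat_Suc)
  also have "\<dots> = of_nat (Suc K) * (-1) ^ K * log_defect K z"
    unfolding power_minus[of "Ln z"] power_minus[of "Ln (z + 1)"]
    by (simp add: log_defect_def log_quot_def log_prim_def field_simps del: of_nat_Suc)
  finally show ?thesis .
qed

text \<open>The circle for the Cauchy estimates: \<open>Re w \<ge> 1/2\<close> on it leaves the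
  decay exponents 1/2 for powers and \<open>1/2 + 2 = 5/2\<close> for trapezoidal errors.\<close>

lemma dist_1_sphere:
  assumes "norm (1 - w) = 1 / 2"
  shows "1 / 2 \<le> Re w" "norm w \<le> 3 / 2"
  using assms complex_Re_le_cmod[of "1 - w"] norm_triangle_ineq4[of 1 "1 - w"] by auto

text \<open>
  Bounds for the powers of logarithms are Cauchy estimates in \<open>w\<close> for bounds of \<open>z powr (-w)\<close> near \<open>w = 1\<close>.
\<close>
lemma log_defect_bound:
  "\<exists>C. \<forall>z u. Re z > 0 \<longrightarrow> 1 \<le> u \<longrightarrow> u \<le> norm z \<longrightarrow> norm (log_defect K z) \<le> C * u powr (-(5/2))"
proof (intro exI allI impI)
  fix z and u :: real assume z: "Re z > 0" "1 \<le> u" "u \<le> norm z"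
  define C0 where "C0 = (3/2 + 1 :: real) ^ 3 * exp (pi * (3/2 + 2))"
  have "norm ((deriv ^^ Suc K) (\<lambda>w. trapezoid_defect w z) 1) \<le> fact (Suc K) * (C0 * u powr (-(5/2))) / (1/2) ^ Suc K"
  proof (rule Cauchy_inequality)
    fix w :: complex assume "norm (1 - w) = 1 / 2"
    from dist_1_sphere[OF this] have "norm (trapezoid_defect w z) \<le> (3/2 + 1) ^ 3 * exp (pi * (3/2 + 2)) * 1 powr (-(3/2 + 2)) * u powr (-(1/2 + 2))"
      using z by (intro norm_trapezoid_defect_le) auto
    then show "norm (trapezoid_defect w z) \<le> C0 * u powr (-(5/2))" by (simp add: C0_def)
  qed (auto intro!: holomorphic_intros holomorphic_on_imp_continuous_on)
  moreover have "z \<noteq> 0" "z + 1 \<noteq> 0" using z by (auto simp: complex_eq_iff)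
  moreover have "norm (log_defect K z) \<le> real (Suc K) * norm (log_defect K z)"
    using mult_right_mono[of 1 "real (Suc K)" "norm (log_defect K z)"] by simp
  ultimately have "norm (log_defect K z) \<le> fact (Suc K) * (C0 * u powr (-(5/2))) / (1/2) ^ Suc K"
    unfolding higher_deriv_trapezoid_defect[OF \<open>z \<noteq> 0\<close> \<open>z + 1 \<noteq> 0\<close>] by (simp add: norm_mult norm_power del: of_nat_Suc)
  then show "norm (log_defect K z)
      \<le> (fact (Suc K) * ((3/2 + 1) ^ 3 * exp (pi * (3/2 + 2))) / (1/2) ^ Suc K) * u powr (-(5/2))"
    by (simp only: C0_def times_divide_eq_left mult.assoc)
qed

lemma log_quot_bound:
  "\<exists>C>0. \<forall>z u. 1 \<le> u \<longrightarrow> u \<le> norm z \<longrightarrow> norm (log_quot K z) \<le> C * u powr (-(1/2))"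
proof (intro exI conjI allI impI)
  fix z :: complex and u :: real assume z: "1 \<le> u" "u \<le> norm z"
  define C0 where "C0 = exp (pi * (3/2))"
  have [simp]: "z \<noteq> 0" using z by auto
  have "norm ((deriv ^^ K) (\<lambda>w. z powr (0 - w)) 1) \<le> fact K * (C0 * u powr (-(1/2))) / (1/2) ^ K"
  proof (rule Cauchy_inequality)
    fix w :: complex assume "norm (1 - w) = 1 / 2"
    from dist_1_sphere[OF this] have "norm (z powr (-w)) \<le> exp (pi * (3/2)) * 1 powr (-(3/2)) * u powr (-(1/2))"
      using z by (intro norm_powr_uminus_le) auto
    then show "norm (z powr (0 - w)) \<le> C0 * u powr (-(1/2))" by (simp add: C0_def)
  qed (auto intro!: holomorphic_intros holomorphic_on_imp_continuous_on)
  then show "norm (log_quot K z) \<le> (fact K * exp (pi * (3/2)) / (1/2) ^ K) * u powr (-(1/2))"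
    unfolding higher_deriv_powr_diff[OF \<open>z \<noteq> 0\<close>]
    by (simp add: C0_def log_quot_def norm_mult norm_power powr_minus_divide norm_divide mult_ac)
qed auto

lemma log_prim_deriv:
  assumes "z \<notin> \<real>\<^sub>\<le>\<^sub>0"
  shows "(log_prim K has_field_derivative log_quot K z) (at z within A)"
proof -
  have "((\<lambda>z. Ln z ^ Suc K / of_nat (Suc K)) has_field_derivative log_quot K z) (at z within A)"
    using assms unfolding log_quot_def
    by (auto intro!: derivative_eq_intros simp: field_simps simp del: of_nat_Suc power_Suc)
  then show ?thesis by (simp only: log_prim_def[abs_def])
qed

section \<open>Limits behind the generalized gamma function\<close>

text \<open>Convexity serves the theorem on limits of derivatives; boundedness makes
  \<open>log_prim K (n + x) - log_prim K n\<close> small uniformly in \<open>x\<close>.\<close>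

definition psi_dom :: "real \<Rightarrow> complex set" where
  "psi_dom M = {z. Re z > 0} \<inter> ball 0 M"

lemma psi_dom_convex: "convex (psi_dom M)" and psi_dom_open: "open (psi_dom M)"
  unfolding psi_dom_def
  by (intro convex_Int convex_halfspace_Re_gt convex_ball open_Int open_halfspace_Re_gt open_ball)+

lemma psi_dom_ge: "x \<in> psi_dom M \<Longrightarrow> real n \<le> norm (of_nat n + x)"
  using complex_Re_le_cmod[of "of_nat n + x"] by (auto simp: psi_dom_def)

lemma tendsto_powr_neg_half: "(\<lambda>n. C * real n powr (-(1/2))) \<longlonglongrightarrow> 0"
  by (intro tendsto_mult_right_zero tendsto_neg_powr filterlim_real_sequentially) simp

lemma uniform_limit_0_bound:
  fixes f :: "nat \<Rightarrow> 'b \<Rightarrow> 'c :: real_normed_vector"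
  assumes "\<And>n x. n \<ge> 1 \<Longrightarrow> x \<in> S \<Longrightarrow> norm (f n x) \<le> b n" "b \<longlonglongrightarrow> 0"
  shows "uniform_limit S f (\<lambda>_. 0) sequentially"
proof (rule uniform_limitI)
  fix e :: real assume "e > 0"
  with assms(2) have "eventually (\<lambda>n. b n < e) sequentially"
    by (rule order_tendstoD)
  then show "eventually (\<lambda>n. \<forall>x\<in>S. dist (f n x) 0 < e) sequentially"
    using eventually_ge_at_top[of 1] by eventually_elim (use assms(1) in force)
qed

lemma log_quot_uniform_limit: "uniform_limit (psi_dom M) (\<lambda>n x. log_quot K (of_nat n + x)) (\<lambda>_. 0) sequentially"
proof -
  obtain C where C: "\<And>z u. 1 \<le> u \<Longrightarrow> u \<le> norm z \<Longrightarrow> norm (log_quot K z) \<le> C * u powr (-(1/2))"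
    using log_quot_bound by meson
  show ?thesis
    by (rule uniform_limit_0_bound[OF _ tendsto_powr_neg_half[of C]]) (use C psi_dom_ge in auto)
qed

text \<open>Mean value inequality: the derivative \<open>log_quot K\<close> is at most of order
  \<open>n powr (-1/2)\<close> to the right of \<open>n\<close>, and the displacement
  \<open>x\<close> stays below \<open>M\<close>.\<close>

lemma log_prim_uniform_limit:
  "uniform_limit (psi_dom M) (\<lambda>n x. log_prim K (of_nat n + x) - log_prim K (of_nat n)) (\<lambda>_. 0) sequentially"
proof -
  obtain C where C: "\<And>z u. 1 \<le> u \<Longrightarrow> u \<le> norm z \<Longrightarrow> norm (log_quot K z) \<le> C * u powr (-(1/2))" "C > 0"
    using log_quot_bound by meson
  have "norm (log_prim K (of_nat n + x) - log_prim K (of_nat n)) \<le> C * M * real n powr (-(1/2))"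
    if n: "n \<ge> 1" and x: "x \<in> psi_dom M" for n x
  proof -
    let ?S = "{z. Re z \<ge> real n}"
    have "norm (log_prim K (of_nat n + x) - log_prim K (of_nat n)) \<le> (C * real n powr (-(1/2))) * norm (of_nat n + x - of_nat n)"
    proof (rule field_differentiable_bound)
      show "convex ?S" by (rule convex_halfspace_Re_ge)
      fix z assume z: "z \<in> ?S"
      show "(log_prim K has_field_derivative log_quot K z) (at z within ?S)"
        using z n by (intro log_prim_deriv Re_pos_notin_nonpos_Reals) auto
      show "norm (log_quot K z) \<le> C * real n powr (-(1/2))"
        using z n complex_Re_le_cmod[of z] by (intro C) auto
    qed (use x in \<open>auto simp: psi_dom_def\<close>)
    also have "\<dots> \<le> (C * real n powr (-(1/2))) * M"
      using x C(2) by (intro mult_left_mono) (auto simp: psi_dom_def)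
    finally show ?thesis by (simp add: mult_ac)
  qed
  then show ?thesis
    by (rule uniform_limit_0_bound[OF _ tendsto_powr_neg_half[of "C * M"]])
qed

text \<open>Summation by the trapezoidal rule: over adjacent unit intervals the inner nodes get
  weight 1, the two ends get 1/2, and the primitives telescope.\<close>

lemma sum_log_quot:
  "(\<Sum>j=0..n. log_quot K (of_nat j + x)) = (\<Sum>j<n. log_defect K (of_nat j + x))
     + (log_quot K x + log_quot K (of_nat n + x)) / 2 + (log_prim K (of_nat n + x) - log_prim K x)"
proof (induction n)
  case 0
  show ?case by simp
next
  case (Suc n)
  have "log_defect K (of_nat n + x) = (log_quot K (of_nat n + x) + log_quot K (of_nat (Suc n) + x)) / 2
      - (log_prim K (of_nat (Suc n) + x) - log_prim K (of_nat n + x))"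
    by (simp add: log_defect_def add_ac)
  with Suc show ?case
    by (simp add: add_divide_distrib del: of_nat_Suc)
qed

lemma log_defect_uniform_limit:
  "uniform_limit (psi_dom M) (\<lambda>n x. \<Sum>j<n. log_defect K (of_nat j + x))
     (\<lambda>x. \<Sum>j. log_defect K (of_nat j + x)) sequentially"
proof -
  obtain C where C: "\<And>z u. Re z > 0 \<Longrightarrow> 1 \<le> u \<Longrightarrow> u \<le> norm z \<Longrightarrow> norm (log_defect K z) \<le> C * u powr (-(5/2))"
    using log_defect_bound by meson
  show ?thesis
  proof (rule Weierstrass_m_test_ev)
    \<comment> \<open>The bound starts at \<open>n = 1\<close>, because the summand
      \<open>n = 0\<close> is unbounded as \<open>x\<close> approaches 0.\<close>
    show "eventually (\<lambda>n. \<forall>x\<in>psi_dom M. norm (log_defect K (of_nat n + x)) \<le> C * real n powr (-(5/2))) sequentially"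
      using eventually_ge_at_top[of 1]
    proof eventually_elim
      case (elim n)
      show ?case
      proof
        fix x assume x: "x \<in> psi_dom M"
        show "norm (log_defect K (of_nat n + x)) \<le> C * real n powr (-(5/2))"
          using elim x psi_dom_ge[OF x] by (intro C) (auto simp: psi_dom_def)
      qed
    qed
    show "summable (\<lambda>n. C * real n powr (-(5/2)))"
      by (intro summable_mult) (simp add: summable_real_powr_iff)
  qed
qed

text \<open>The products in \<open>gen_Gamma\<close> are exponentials of explicit sums
  \<open>Q n\<close>, which avoids any choice of a branch. The derivatives of \<open>Q n\<close>
  converge uniformly and \<open>Q n\<close> converges at one point; hence \<open>Q n\<close> has a
  differentiable limit \<open>g\<close>, and the logarithmic derivative of \<open>exp (g x)\<close>
  is the limit of the derivatives.\<close>

lemma gen_psi_eq: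
  assumes x: "Re x > 0"
  shows "gen_psi K x = log_prim K x - log_quot K x / 2 - (\<Sum>j. log_defect K (of_nat j + x))"
proof -
  \<comment> \<open>Large enough for the disc to contain both \<open>x\<close> and the reference
    point 1.\<close>
  define M where "M = norm x + 2"
  let ?S = "psi_dom M"
  have xS: "x \<in> ?S" and oneS: "1 \<in> ?S" using x by (auto simp: psi_dom_def M_def add_pos_nonneg)
  define Q where "Q = (\<lambda>n x. log_prim K (of_nat n) * x + (\<Sum>j=1..n. log_prim K (of_nat j))
      - (\<Sum>j=0..n. log_prim K (of_nat j + x)))"
  define Q' where "Q' = (\<lambda>n x. log_prim K (of_nat n) - (\<Sum>j=0..n. log_quot K (of_nat j + x)))"
  define g' where "g' = (\<lambda>x. log_prim K x - log_quot K x / 2 - (\<Sum>j. log_defect K (of_nat j + x)))"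
  have gen_Gamma_eq: "gen_Gamma K y = lim (\<lambda>n. exp (Q n y))" for y
    unfolding gen_Gamma_def Q_def log_prim_def Suc_eq_plus1
    by (simp only: exp_diff exp_add exp_sum finite_atLeastAtMost)
  have deriv: "(Q n has_field_derivative Q' n y) (at y within ?S)" if "y \<in> ?S" for n y
  proof -
    have "of_nat j + y \<notin> \<real>\<^sub>\<le>\<^sub>0" for j :: nat
      using that by (intro Re_pos_notin_nonpos_Reals) (auto simp: psi_dom_def add_nonneg_pos)
    then show ?thesis
      unfolding Q_def Q'_def
      by (auto intro!: derivative_eq_intros DERIV_chain2[OF log_prim_deriv])
  qed
  have lim: "uniform_limit ?S Q' g' sequentially"
  proof -
    have "uniform_limit ?S (\<lambda>n y. (log_prim K y - log_quot K y / 2) - (\<Sum>j<n. log_defect K (of_nat j + y))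
        - (1 / 2) * log_quot K (of_nat n + y) - (log_prim K (of_nat n + y) - log_prim K (of_nat n)))
      (\<lambda>y. (log_prim K y - log_quot K y / 2) - (\<Sum>j. log_defect K (of_nat j + y)) - (1 / 2) * 0 - 0) sequentially"
      by (intro uniform_limit_intros log_defect_uniform_limit log_prim_uniform_limit
            bounded_linear.uniform_limit[OF bounded_linear_mult_right] log_quot_uniform_limit)
    then show ?thesis
      unfolding Q'_def g'_def sum_log_quot by (simp add: algebra_simps add_divide_distrib)
  qed
  have Q1: "Q n 1 = - (log_prim K (of_nat n + 1) - log_prim K (of_nat n))" for n
  proof -
    have "(\<Sum>j=0..n. log_prim K (of_nat j + 1)) = (\<Sum>j=0..n. log_prim K (of_nat (Suc j)))"
      by (simp add: add.commute)
    also have "\<dots> = (\<Sum>j=1..Suc n. log_prim K (of_nat j))"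
      by (subst sum.shift_bounds_cl_Suc_ivl[symmetric]) simp
    finally show ?thesis by (simp add: Q_def add.commute)
  qed
  \<comment> \<open>At 1 the two sums differ by a single term, and the increments of
    \<open>log_prim\<close> tend to 0.\<close>
  have Q1_lim: "(\<lambda>n. Q n 1) \<longlonglongrightarrow> - 0"
    unfolding Q1 using tendsto_uniform_limitI[OF log_prim_uniform_limit oneS] by (intro tendsto_minus)
  have "\<exists>g. \<forall>y\<in>?S. (\<lambda>n. Q n y) \<longlonglongrightarrow> g y \<and> (g has_derivative (\<lambda>h. g' y * h)) (at y within ?S)"
  proof (rule has_derivative_sequence[where f' = "\<lambda>n y h. Q' n y * h" and f = Q])
    show "(Q n has_derivative (\<lambda>h. Q' n y * h)) (at y within ?S)" if "y \<in> ?S" for n y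
      using deriv[OF that] by (simp add: has_field_derivative_def)
    show "\<forall>\<^sub>F n in sequentially. \<forall>y\<in>?S. \<forall>h. norm (Q' n y * h - g' y * h) \<le> e * norm h" if "e > 0" for e
      using uniform_limitD[OF lim that]
      by eventually_elim
         (auto simp: dist_norm norm_mult left_diff_distrib[symmetric] intro!: mult_right_mono intro: less_imp_le)
  qed (fact psi_dom_convex oneS Q1_lim)+
  then obtain g where g: "\<And>y. y \<in> ?S \<Longrightarrow> (\<lambda>n. Q n y) \<longlonglongrightarrow> g y"
      "\<And>y. y \<in> ?S \<Longrightarrow> (g has_field_derivative g' y) (at y within ?S)"
    by (auto simp: has_field_derivative_def)
  have eq: "gen_Gamma K y = exp (g y)" if "y \<in> ?S" for y
    unfolding gen_Gamma_eq using tendsto_exp[OF g(1)[OF that]] by (rule limI)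
  have "((\<lambda>y. exp (g y)) has_field_derivative exp (g x) * g' x) (at x)"
    using g(2)[OF xS] at_within_open[OF xS psi_dom_open] by (auto intro!: derivative_eq_intros)
  then have "(gen_Gamma K has_field_derivative exp (g x) * g' x) (at x)"
    by (rule has_field_derivative_transform_within_open[OF _ psi_dom_open xS]) (simp add: eq)
  then show ?thesis
    unfolding gen_psi_def by (simp add: DERIV_imp_deriv eq[OF xS] g'_def)
qed

subsection \<open>Higher Herglotz functions as Taylor coefficients\<close>

text \<open>The two correction terms in each bracket of \<open>frakF0\<close> cancel the boundary
  terms in \<open>gen_psi_eq\<close>. What remains is minus the sum of \<open>log_defect K\<close>
  along one column, and the columns together form the differentiated double sum.\<close>

lemma frakF0_eq:
  assumes x: "x > 0"
  shows "frakF0 (Suc K) (of_real x) = - ((-1) ^ K * (deriv ^^ Suc K) (\<lambda>w. trapezoid_defect_sum w x) 1 / of_nat (Suc K))"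
proof -
  define y where "y = (\<lambda>m. real (Suc m) * x)"
  have y: "y m > 0" for m using x by (simp add: y_def)
  define T where "T = (deriv ^^ Suc K) (\<lambda>w. trapezoid_defect_sum w x) 1"
  have eq: "(deriv ^^ Suc K) (\<lambda>w. trapezoid_defect w (of_real (real (Suc m) * x + real n))) 1
      = of_nat (Suc K) * (-1) ^ K * log_defect K (of_nat n + of_real (y m))" for m n
  proof -
    have "y m + real n > 0" using y[of m] by simp
    then have "(of_real (y m + real n) :: complex) \<noteq> 0" "of_real (y m + real n) + (1 :: complex) \<noteq> 0"
      by (auto simp: complex_eq_iff simp del: of_real_add)
    from higher_deriv_trapezoid_defect[OF this] show ?thesis by (simp add: y_def add.commute)
  qed
  have 1: "((\<lambda>(m, n). of_nat (Suc K) * (-1) ^ K * log_defect K (of_nat n + of_real (y m))) has_sum T) (UNIV \<times> UNIV)"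
    using trapezoid_defect_sum_deriv_has_sum[OF x, of 1 "Suc K"] unfolding eq T_def by simp
  have inner: "(\<lambda>n. of_nat (Suc K) * (-1) ^ K * log_defect K (of_nat n + of_real (y m))) summable_on UNIV" for m
    using summable_on_SigmaD1[OF has_sum_imp_summable[OF 1], of m] by simp
  have inner_sum: "((\<lambda>n. of_nat (Suc K) * (-1) ^ K * log_defect K (of_nat n + of_real (y m))) has_sum
      of_nat (Suc K) * (-1) ^ K * (\<Sum>n. log_defect K (of_nat n + of_real (y m)))) UNIV" for m
  proof -
    let ?c = "of_nat (Suc K) * (-1) ^ K :: complex"
    have c: "?c \<noteq> 0" by (simp del: of_nat_Suc)
    have "(\<lambda>n. ?c * log_defect K (of_nat n + of_real (y m))) sums
       infsum (\<lambda>n. ?c * log_defect K (of_nat n + of_real (y m))) UNIV"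
      using has_sum_infsum[OF inner] by (rule has_sum_imp_sums)
    moreover from this have "summable (\<lambda>n. ?c * log_defect K (of_nat n + of_real (y m)))"
      by (rule sums_summable)
    then have "summable (\<lambda>n. log_defect K (of_nat n + of_real (y m)))"
      using c by (simp only: summable_cmult_iff) simp
    then have "(\<lambda>n. ?c * log_defect K (of_nat n + of_real (y m))) sums
       (?c * (\<Sum>n. log_defect K (of_nat n + of_real (y m))))"
      by (intro sums_mult summable_sums)
    ultimately have "infsum (\<lambda>n. ?c * log_defect K (of_nat n + of_real (y m))) UNIV
        = ?c * (\<Sum>n. log_defect K (of_nat n + of_real (y m)))"
      by (rule sums_unique2)
    with has_sum_infsum[OF inner[of m]] show ?thesis by (simp only:)
  qed
  have "((\<lambda>m. of_nat (Suc K) * (-1) ^ K * (\<Sum>n. log_defect K (of_nat n + of_real (y m)))) has_sum T) UNIV"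
    by (rule has_sum_SigmaD[OF 1]) (use inner_sum in simp)
  then have "(\<lambda>m. (- ((-1) ^ K / of_nat (Suc K))) * (of_nat (Suc K) * (-1) ^ K * (\<Sum>n. log_defect K (of_nat n + of_real (y m)))))
      sums ((- ((-1) ^ K / of_nat (Suc K))) * T)"
    by (intro sums_mult has_sum_imp_sums)
  moreover have "(- ((-1) ^ K / of_nat (Suc K))) * (of_nat (Suc K) * (-1) ^ K * S) = - S" for S :: complex
  proof -
    have "(- ((-1) ^ K / of_nat (Suc K))) * (of_nat (Suc K) * (-1) ^ K * S)
        = - (((-1) ^ K * (-1) ^ K) * (of_nat (Suc K) / of_nat (Suc K)) * S)"
      by (simp add: mult_ac del: of_nat_Suc)
    also have "(-1) ^ K * (-1) ^ K = (1 :: complex)"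
      by (simp flip: power_mult_distrib)
    finally show ?thesis by (simp del: of_nat_Suc)
  qed
  ultimately have "(\<lambda>m. - (\<Sum>n. log_defect K (of_nat n + of_real (y m)))) sums (- ((-1) ^ K / of_nat (Suc K)) * T)"
    by simp
  moreover have "- (\<Sum>n. log_defect K (of_nat n + of_real (y m)))
    = gen_psi K (of_real (y m)) + Ln (of_real (y m)) ^ K / (2 * of_real (y m)) - Ln (of_real (y m)) ^ Suc K / of_nat (Suc K)" for m
    using y[of m] by (subst gen_psi_eq) (simp_all add: log_quot_def log_prim_def mult.commute del: of_nat_Suc)
  moreover have "of_nat (Suc m) * complex_of_real x = of_real (y m)" for m
    by (simp add: y_def)
  ultimately show ?thesis
    unfolding frakF0_def Let_def diff_Suc_1 T_def by (simp add: sums_unique[symmetric])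
qed

text \<open>The summands of \<open>eisen_period\<close> match those of \<open>calF\<close>: the
  double sum gives \<open>frakF0\<close>, the Leibniz rule for
  \<open>x powr (1 - w) * zeta (w - 1)\<close> gives the sum over the derivatives of \<zeta> at 0,
  and \<open>zeta_regular w / 2\<close> gives the Stieltjes constant.\<close>

lemma eisen_period_deriv:
  assumes x: "x > 0"
  shows "(deriv ^^ k) (eisen_period x) 1 = - (of_nat k * calF k (of_real x))"
proof (cases k)
  case 0
  then show ?thesis using eisen_period_1[OF x] by simp
next
  case (Suc K)
  let ?A = "{w. Re w > 0} - {2}"
  have A: "open ?A" "1 \<in> ?A"
    by (auto intro: open_delete open_halfspace_Re_gt)
  have zeta_shift: "(\<lambda>w. zeta (w - 1)) holomorphic_on - {2}"
    unfolding o_def[symmetric, of zeta "\<lambda>w. w - 1"]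
    by (intro holomorphic_on_compose_gen[OF _ zeta_holomorphic] holomorphic_intros) (auto simp: algebra_simps)
  have zeta_deriv: "(deriv ^^ n) (\<lambda>w. zeta (w - 1)) 1 = (deriv ^^ n) zeta 0" for n
    using higher_deriv_compose_linear'[OF zeta_holomorphic, of "- {2}" 1 1 "-1" n]
    by (simp add: open_Compl algebra_simps)
  have hol: "(\<lambda>w. trapezoid_defect_sum w x) holomorphic_on ?A"
      "(\<lambda>w. of_real x powr (1 - w) * zeta (w - 1)) holomorphic_on ?A"
      "(\<lambda>w. zeta_regular w) holomorphic_on ?A"
    using x by (intro holomorphic_on_subset[OF trapezoid_defect_sum_holomorphic] holomorphic_intros zeta_regular_holomorphic
         holomorphic_on_subset[OF zeta_shift]; auto)+
  have "(deriv ^^ k) (eisen_period x) 1 = (deriv ^^ k) (\<lambda>w. trapezoid_defect_sum w x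
       + of_real x powr (1 - w) * zeta (w - 1) + (1 / 2) * zeta_regular w) 1"
    by (simp add: eisen_period_def[abs_def])
  also have "\<dots> = (deriv ^^ k) (\<lambda>w. trapezoid_defect_sum w x) 1
      + (deriv ^^ k) (\<lambda>w. of_real x powr (1 - w) * zeta (w - 1)) 1 + 1 / 2 * (deriv ^^ k) zeta_regular 1"
    by (simp only: higher_deriv_add[OF holomorphic_on_add[OF hol(1,2)] holomorphic_on_mult[OF holomorphic_on_const hol(3)] A]
          higher_deriv_add[OF hol(1,2) A] higher_deriv_cmult[OF hol(3) A(2,1)])
  also have "(deriv ^^ k) (\<lambda>w. of_real x powr (1 - w) * zeta (w - 1)) 1
     = (\<Sum>l=0..k. of_nat (k choose l) * (deriv ^^ l) (\<lambda>w. of_real x powr (1 - w)) 1 * (deriv ^^ (k - l)) (\<lambda>w. zeta (w - 1)) 1)"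
    by (intro higher_deriv_mult[OF _ zeta_shift]) (use x in \<open>auto intro!: holomorphic_intros simp: open_Compl\<close>)
  also have "\<dots> = of_nat k * (\<Sum>l=0..k. (-1) ^ l / of_nat k * of_nat (k choose l) * Ln (of_real x) ^ l * (deriv ^^ (k - l)) zeta 0)"
    unfolding sum_distrib_left using x Suc
    by (intro sum.cong refl)
       (simp add: zeta_deriv higher_deriv_powr_diff power_minus[of "Ln _"] del: of_nat_Suc)
  also have "(deriv ^^ k) (\<lambda>w. trapezoid_defect_sum w x) 1 = - of_nat k * ((-1) ^ (k - 1) * frakF0 k (of_real x))"
    unfolding Suc frakF0_eq[OF x] by (simp flip: power_mult_distrib del: of_nat_Suc funpow.simps)
  also have "(deriv ^^ k) zeta_regular 1 = of_nat k * ((-1) ^ (k - 1) * stieltjes (k - 1))"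
    unfolding Suc stieltjes_eq diff_Suc_1 by (simp flip: power_mult_distrib del: of_nat_Suc funpow.simps)
  finally show ?thesis
    by (simp add: calF_def algebra_simps)
qed

text \<open>The factor \<open>j\<close> attached to \<open>calF j\<close> by
  \<open>eisen_period_deriv\<close> merges with the Leibniz coefficient:
  \<open>j * (k choose j) = k * ((k - 1) choose (j - 1))\<close>. It also removes
  \<open>j = 0\<close>.\<close>

lemma higher_deriv_mult_eisen_period:
  assumes x: "x > 0" and a: "a holomorphic_on UNIV"
  shows "(deriv ^^ k) (\<lambda>w. a w * eisen_period x w) 1
    = - of_nat k * (\<Sum>j=1..k. of_nat ((k - 1) choose (j - 1)) * ((deriv ^^ (k - j)) a 1 * calF j (of_real x)))"
proof -
  let ?A = "{w. Re w > 0} - {2}"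
  have "(deriv ^^ k) (\<lambda>w. a w * eisen_period x w) 1
     = (\<Sum>i=0..k. of_nat (k choose i) * (deriv ^^ i) a 1 * (deriv ^^ (k - i)) (eisen_period x) 1)"
    by (intro higher_deriv_mult[OF _ eisen_period_holomorphic[OF x]])
       (auto intro: holomorphic_on_subset[OF a] open_delete open_halfspace_Re_gt)
  also have "\<dots> = (\<Sum>j=0..k. of_nat (k choose (k - j)) * (deriv ^^ (k - j)) a 1 * (deriv ^^ (k - (k - j))) (eisen_period x) 1)"
    by (subst sum.atLeastAtMost_rev) simp
  also have "\<dots> = (\<Sum>j=0..k. - (of_nat (j * (k choose j)) * ((deriv ^^ (k - j)) a 1 * calF j (of_real x))))"
    by (intro sum.cong refl) (simp add: eisen_period_deriv[OF x] binomial_symmetric[symmetric])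
  also have "\<dots> = (\<Sum>j=1..k. - (of_nat (j * (k choose j)) * ((deriv ^^ (k - j)) a 1 * calF j (of_real x))))"
    by (intro sum.mono_neutral_right) auto
  also have "\<dots> = (\<Sum>j=1..k. - of_nat k * (of_nat ((k - 1) choose (j - 1)) * ((deriv ^^ (k - j)) a 1 * calF j (of_real x))))"
    by (intro sum.cong refl) (subst times_binomial_minus1_eq, auto)
  finally show ?thesis by (simp add: sum_distrib_left)
qed

subsection \<open>Hecke relations\<close>

text \<open>
  \<open>W\<close> transports the boundary weights to the sublattice \<open>range M\<close> and vanishes off it, so that all the sums
  of a Hecke relation run over the same linear form \<open>a x + b\<close>.
\<close>
lemma lat_sum_reindex:
  fixes p q r s :: nat
  assumes W: "\<And>m n. W (m * p + n * r, m * q + n * s) = half_wt m * half_wt n"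
    and range: "\<And>a b. W (a, b) \<noteq> 0 \<Longrightarrow> \<exists>m n. a = m * p + n * r \<and> b = m * q + n * s"
    and det: "p * s \<noteq> q * r"
    and x: "x > 0" and w: "Re w > 2"
  shows "((\<lambda>c. W c * of_real (real (fst c) * x + real (snd c)) powr (-w)) has_sum
           lat_sum w (real p * x + real q) (real r * x + real s)) UNIV"
proof -
  define M where "M = (\<lambda>(m, n). (m * p + n * r, m * q + n * s))"
  let ?f = "\<lambda>c. W c * of_real (real (fst c) * x + real (snd c)) powr (-w)"
  let ?g = "\<lambda>(m, n). half_wt m * half_wt n *
      of_real (real m * (real p * x + real q) + real n * (real r * x + real s)) powr (-w)"
  have inj: "inj M"
  proof (rule injI)
    fix c c' assume eq: "M c = M c'"
    obtain m n m' n' where c: "c = (m, n)" "c' = (m', n')" by fastforce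
    have "int (m * p + n * r) = int (m' * p + n' * r)" "int (m * q + n * s) = int (m' * q + n' * s)"
      using eq by (simp_all add: M_def c)
    then have "int m * int p + int n * int r = int m' * int p + int n' * int r"
      "int m * int q + int n * int s = int m' * int q + int n' * int s"
      by simp_all
    \<comment> \<open>Cramer's rule: the determinant times each difference of coordinates
      vanishes.\<close>
    then have "(int m - int m') * (int p * int s - int q * int r) = 0"
      "(int n - int n') * (int p * int s - int q * int r) = 0"
      by algebra+
    moreover have "int p * int s - int q * int r \<noteq> 0"
      using det by (metis diff_eq_diff_eq diff_self of_nat_eq_iff of_nat_mult)
    ultimately show "c = c'" by (simp add: c)
  qed
  \<comment> \<open>A nonzero determinant means that neither \<open>(p, q)\<close> nor
    \<open>(r, s)\<close> is the zero vector.\<close>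
  have pos: "real p * x + real q > 0" "real r * x + real s > 0"
    using det x by (cases "p = 0"; cases "q = 0"; cases "r = 0"; cases "s = 0"; simp add: add_pos_nonneg add_nonneg_pos)+
  have "?f (M c) = ?g c" for c
    by (cases c) (simp add: M_def W algebra_simps)
  then have "?f \<circ> M = ?g"
    by (simp add: fun_eq_iff)
  then have "((?f \<circ> M) has_sum lat_sum w (real p * x + real q) (real r * x + real s)) UNIV"
    using lat_sum_has_sum[OF pos w] by (simp only:)
  then have "(?f has_sum lat_sum w (real p * x + real q) (real r * x + real s)) (range M)"
    by (simp only: has_sum_reindex[OF inj])
  moreover have "c \<in> range M" if "W c \<noteq> 0" for c
    using range[of "fst c" "snd c"] that by (cases c) (auto simp: M_def image_iff)
  then have "(?f has_sum lat_sum w (real p * x + real q) (real r * x + real s)) (range M) \<longleftrightarrow>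
      (?f has_sum lat_sum w (real p * x + real q) (real r * x + real s)) UNIV"
    by (intro has_sum_cong_neutral) auto
  ultimately show ?thesis by blast
qed

text \<open>\<open>W1\<close> and \<open>W2\<close> belong to the lattices of even \<open>a\<close>
  and of even \<open>b\<close>. The lattice of even \<open>a + b\<close> is cut along the diagonal
  into \<open>W3\<close> and \<open>W4\<close>, each generated by its edge vectors.
  \<open>W5\<close> marks the points common to all three, counted \<open>3 = 1 + 2\<close>
  times.\<close>

lemma lat_sum_hecke_2:
  assumes x: "x > 0" and w: "Re w > 2"
  shows "lat_sum w (2 * x) 1 + lat_sum w x 2 + lat_sum w (x + 1) 2 + lat_sum w (2 * x) (x + 1)
       = lat_sum w x 1 + 2 * lat_sum w (2 * x) 2"
proof -
  define F where "F = (\<lambda>c. of_real (real (fst c) * x + real (snd c)) powr (-w) :: complex)"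
  define E where "E = (\<lambda>(a, b). half_wt a * half_wt b)"
  define W1 where "W1 = (\<lambda>(a, b). if even a then half_wt a * half_wt b else 0)"
  define W2 where "W2 = (\<lambda>(a, b). if even b then half_wt a * half_wt b else 0)"
  define W3 where "W3 = (\<lambda>(a, b). if a \<le> b \<and> even (a + b) then half_wt a * half_wt (b - a) else 0)"
  define W4 where "W4 = (\<lambda>(a, b). if b \<le> a \<and> even (a + b) then half_wt b * half_wt (a - b) else 0)"
  define W5 where "W5 = (\<lambda>(a, b). if even a \<and> even b then half_wt a * half_wt b else 0)"
  have S: "((\<lambda>c. E c * F c) has_sum lat_sum w x 1) UNIV"
    using lat_sum_has_sum[of x 1 w] x w by (simp add: E_def F_def case_prod_unfold)
  have S1: "((\<lambda>c. W1 c * F c) has_sum lat_sum w (2 * x) 1) UNIV"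
  proof -
    have "W1 (m * 2 + n * 0, m * 0 + n * 1) = half_wt m * half_wt n" for m n
      unfolding W1_def prod.case half_wt_def by (auto; presburger)
    moreover have "\<exists>m n. a = m * 2 + n * 0 \<and> b = m * 0 + n * 1" if "W1 (a, b) \<noteq> 0" for a b
    proof -
      have c: "even a"
        using that by (auto simp only: W1_def prod.case split: if_splits)
      then obtain k where "a = 2 * k" by (blast elim: dvdE)
      with c show ?thesis by (intro exI[of _ "k"] exI[of _ "b"]) linarith
    qed
    ultimately show ?thesis
      using lat_sum_reindex[of W1 2 0 0 1 x w] x w by (simp add: F_def)
  qed
  have S2: "((\<lambda>c. W2 c * F c) has_sum lat_sum w x 2) UNIV"
  proof -
    have "W2 (m * 1 + n * 0, m * 0 + n * 2) = half_wt m * half_wt n" for m n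
      unfolding W2_def prod.case half_wt_def by (auto; presburger)
    moreover have "\<exists>m n. a = m * 1 + n * 0 \<and> b = m * 0 + n * 2" if "W2 (a, b) \<noteq> 0" for a b
    proof -
      have c: "even b"
        using that by (auto simp only: W2_def prod.case split: if_splits)
      then obtain k where "b = 2 * k" by (blast elim: dvdE)
      with c show ?thesis by (intro exI[of _ "a"] exI[of _ "k"]) linarith
    qed
    ultimately show ?thesis
      using lat_sum_reindex[of W2 1 0 0 2 x w] x w by (simp add: F_def)
  qed
  have S3: "((\<lambda>c. W3 c * F c) has_sum lat_sum w (x + 1) 2) UNIV"
  proof -
    have "W3 (m * 1 + n * 0, m * 1 + n * 2) = half_wt m * half_wt n" for m n
      unfolding W3_def prod.case half_wt_def by (auto; presburger)
    moreover have "\<exists>m n. a = m * 1 + n * 0 \<and> b = m * 1 + n * 2" if "W3 (a, b) \<noteq> 0" for a b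
    proof -
      have c: "a \<le> b \<and> even (a + b)"
        using that by (auto simp only: W3_def prod.case split: if_splits)
      then obtain k where "a + b = 2 * k" by (blast elim: dvdE)
      \<comment> \<open>The coordinate \<open>(b - a) / 2\<close> along \<open>(0, 2)\<close>,
        written as \<open>b - k\<close>.\<close>
      with c show ?thesis by (intro exI[of _ "a"] exI[of _ "b - k"]) linarith
    qed
    ultimately show ?thesis
      using lat_sum_reindex[of W3 1 0 1 2 x w] x w by (simp add: F_def)
  qed
  have S4: "((\<lambda>c. W4 c * F c) has_sum lat_sum w (2 * x) (x + 1)) UNIV"
  proof -
    have "W4 (m * 2 + n * 1, m * 0 + n * 1) = half_wt m * half_wt n" for m n
      unfolding W4_def prod.case half_wt_def by (auto; presburger)
    moreover have "\<exists>m n. a = m * 2 + n * 1 \<and> b = m * 0 + n * 1" if "W4 (a, b) \<noteq> 0" for a b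
    proof -
      have c: "b \<le> a \<and> even (a + b)"
        using that by (auto simp only: W4_def prod.case split: if_splits)
      then obtain k where "a + b = 2 * k" by (blast elim: dvdE)
      with c show ?thesis by (intro exI[of _ "a - k"] exI[of _ "b"]) linarith
    qed
    ultimately show ?thesis
      using lat_sum_reindex[of W4 2 1 0 1 x w] x w by (simp add: F_def)
  qed
  have S5: "((\<lambda>c. W5 c * F c) has_sum lat_sum w (2 * x) 2) UNIV"
  proof -
    have "W5 (m * 2 + n * 0, m * 0 + n * 2) = half_wt m * half_wt n" for m n
      unfolding W5_def prod.case half_wt_def by (auto; presburger)
    moreover have "\<exists>m n. a = m * 2 + n * 0 \<and> b = m * 0 + n * 2" if "W5 (a, b) \<noteq> 0" for a b
    proof -
      have c: "even a \<and> even b"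
        using that by (auto simp only: W5_def prod.case split: if_splits)
      then show ?thesis by (intro exI[of _ "a div 2"] exI[of _ "b div 2"]) auto
    qed
    ultimately show ?thesis
      using lat_sum_reindex[of W5 2 0 0 2 x w] x w by (simp add: F_def)
  qed
  have F0: "F (0, 0) = 0" by (simp add: F_def)
  \<comment> \<open>The weights do not match at the origin, where the left side is 1 and the right
    side 3/4; there \<open>F\<close> vanishes.\<close>
  have "W1 c + W2 c + W3 c + W4 c = E c + 2 * W5 c" if "c \<noteq> (0, 0)" for c
  proof -
    obtain a b where c: "c = (a, b)" by fastforce
    have "W3 c + W4 c = (if even (a + b) then half_wt a * half_wt b else 0)"
      using that by (auto simp: c W3_def W4_def half_wt_def)
    then show ?thesis
      by (auto simp: c W1_def W2_def W5_def E_def add.assoc)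
  qed
  then have eq: "(W1 c + W2 c + W3 c + W4 c) * F c = (E c + 2 * W5 c) * F c" for c
    using F0 by (cases "c = (0, 0)") auto
  have "((\<lambda>c. W1 c * F c + W2 c * F c + W3 c * F c + W4 c * F c) has_sum
       lat_sum w (2 * x) 1 + lat_sum w x 2 + lat_sum w (x + 1) 2 + lat_sum w (2 * x) (x + 1)) UNIV"
    by (intro has_sum_add S1 S2 S3 S4)
  moreover have "((\<lambda>c. E c * F c + 2 * (W5 c * F c)) has_sum lat_sum w x 1 + 2 * lat_sum w (2 * x) 2) UNIV"
    by (intro has_sum_add has_sum_cmult_right S S5)
  moreover have "(\<lambda>c. W1 c * F c + W2 c * F c + W3 c * F c + W4 c * F c) = (\<lambda>c. E c * F c + 2 * (W5 c * F c))"
    using eq by (simp add: algebra_simps)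
  ultimately show ?thesis
    by (simp only:) (erule (1) has_sum_unique)
qed

text \<open>The lattice \<open>3 dvd (a + 2 * b)\<close> contains \<open>(1, 1)\<close> and splits
  along it into \<open>W3\<close> and \<open>W6\<close>. The lattice \<open>3 dvd (a + b)\<close> is
  cut along both \<open>(1, 2)\<close> and \<open>(2, 1)\<close> into \<open>W4\<close>,
  \<open>W5\<close>, \<open>W7\<close>: a cut along only one of these rays leaves a cone with edge
  determinant 6, whose edge vectors generate a proper sublattice. Points of \<open>W8\<close> lie in
  all four lattices, \<open>4 = 1 + 3\<close>.\<close>

lemma lat_sum_hecke_3:
  assumes x: "x > 0" and w: "Re w > 2"
  shows "lat_sum w (3 * x) 1 + lat_sum w x 3 + lat_sum w (x + 1) 3 + lat_sum w (x + 2) 3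
         + lat_sum w (2 * x + 1) (x + 2) + lat_sum w (3 * x) (x + 1) + lat_sum w (3 * x) (2 * x + 1)
       = lat_sum w x 1 + 3 * lat_sum w (3 * x) 3"
proof -
  define F where "F = (\<lambda>c. of_real (real (fst c) * x + real (snd c)) powr (-w) :: complex)"
  define E where "E = (\<lambda>(a, b). half_wt a * half_wt b)"
  define W1 where "W1 = (\<lambda>(a, b). if 3 dvd a then half_wt a * half_wt b else 0)"
  define W2 where "W2 = (\<lambda>(a, b). if 3 dvd b then half_wt a * half_wt b else 0)"
  \<comment> \<open>Divisibility of \<open>a + 2 * b\<close> expresses that \<open>a\<close> and
    \<open>b\<close> are congruent modulo 3 without subtraction of naturals.\<close>
  define W3 where "W3 = (\<lambda>(a, b). if a \<le> b \<and> 3 dvd (a + 2 * b) then half_wt a * half_wt (b - a) else 0)"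
  define W4 where "W4 = (\<lambda>(a, b). if 2 * a \<le> b \<and> 3 dvd (a + b) then half_wt a * half_wt (b - 2 * a) else 0)"
  \<comment> \<open>The coordinates with respect to \<open>(2, 1)\<close> and \<open>(1, 2)\<close>
    are \<open>(2 * a - b) / 3\<close> and \<open>(2 * b - a) / 3\<close>; \<open>half_wt\<close>
    only sees whether they vanish.\<close>
  define W5 where "W5 = (\<lambda>(a, b). if b \<le> 2 * a \<and> a \<le> 2 * b \<and> 3 dvd (a + b)
                             then half_wt (2 * a - b) * half_wt (2 * b - a) else 0)"
  define W6 where "W6 = (\<lambda>(a, b). if b \<le> a \<and> 3 dvd (a + 2 * b) then half_wt b * half_wt (a - b) else 0)"
  define W7 where "W7 = (\<lambda>(a, b). if 2 * b \<le> a \<and> 3 dvd (a + b) then half_wt b * half_wt (a - 2 * b) else 0)"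
  define W8 where "W8 = (\<lambda>(a, b). if 3 dvd a \<and> 3 dvd b then half_wt a * half_wt b else 0)"
  have S: "((\<lambda>c. E c * F c) has_sum lat_sum w x 1) UNIV"
    using lat_sum_has_sum[of x 1 w] x w by (simp add: E_def F_def case_prod_unfold)
  have S1: "((\<lambda>c. W1 c * F c) has_sum lat_sum w (3 * x) 1) UNIV"
  proof -
    have "W1 (m * 3 + n * 0, m * 0 + n * 1) = half_wt m * half_wt n" for m n
      unfolding W1_def prod.case half_wt_def by (auto; presburger)
    moreover have "\<exists>m n. a = m * 3 + n * 0 \<and> b = m * 0 + n * 1" if "W1 (a, b) \<noteq> 0" for a b
    proof -
      have c: "3 dvd a"
        using that by (auto simp only: W1_def prod.case split: if_splits)
      then obtain k where "a = 3 * k" by (blast elim: dvdE)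
      with c show ?thesis by (intro exI[of _ "k"] exI[of _ "b"]) linarith
    qed
    ultimately show ?thesis
      using lat_sum_reindex[of W1 3 0 0 1 x w] x w by (simp add: F_def)
  qed
  have S2: "((\<lambda>c. W2 c * F c) has_sum lat_sum w x 3) UNIV"
  proof -
    have "W2 (m * 1 + n * 0, m * 0 + n * 3) = half_wt m * half_wt n" for m n
      unfolding W2_def prod.case half_wt_def by (auto; presburger)
    moreover have "\<exists>m n. a = m * 1 + n * 0 \<and> b = m * 0 + n * 3" if "W2 (a, b) \<noteq> 0" for a b
    proof -
      have c: "3 dvd b"
        using that by (auto simp only: W2_def prod.case split: if_splits)
      then obtain k where "b = 3 * k" by (blast elim: dvdE)
      with c show ?thesis by (intro exI[of _ "a"] exI[of _ "k"]) linarith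
    qed
    ultimately show ?thesis
      using lat_sum_reindex[of W2 1 0 0 3 x w] x w by (simp add: F_def)
  qed
  have S3: "((\<lambda>c. W3 c * F c) has_sum lat_sum w (x + 1) 3) UNIV"
  proof -
    have "W3 (m * 1 + n * 0, m * 1 + n * 3) = half_wt m * half_wt n" for m n
      unfolding W3_def prod.case half_wt_def by (auto; presburger)
    moreover have "\<exists>m n. a = m * 1 + n * 0 \<and> b = m * 1 + n * 3" if "W3 (a, b) \<noteq> 0" for a b
    proof -
      have c: "a \<le> b \<and> 3 dvd (a + 2 * b)"
        using that by (auto simp only: W3_def prod.case split: if_splits)
      then obtain k where "a + 2 * b = 3 * k" by (blast elim: dvdE)
      with c show ?thesis by (intro exI[of _ "a"] exI[of _ "b - k"]) linarith
    qed
    ultimately show ?thesis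
      using lat_sum_reindex[of W3 1 0 1 3 x w] x w by (simp add: F_def)
  qed
  have S4: "((\<lambda>c. W4 c * F c) has_sum lat_sum w (x + 2) 3) UNIV"
  proof -
    have "W4 (m * 1 + n * 0, m * 2 + n * 3) = half_wt m * half_wt n" for m n
      unfolding W4_def prod.case half_wt_def by (auto; presburger)
    moreover have "\<exists>m n. a = m * 1 + n * 0 \<and> b = m * 2 + n * 3" if "W4 (a, b) \<noteq> 0" for a b
    proof -
      have c: "2 * a \<le> b \<and> 3 dvd (a + b)"
        using that by (auto simp only: W4_def prod.case split: if_splits)
      then obtain k where "a + b = 3 * k" by (blast elim: dvdE)
      with c show ?thesis by (intro exI[of _ "a"] exI[of _ "k - a"]) linarith
    qed
    ultimately show ?thesis
      using lat_sum_reindex[of W4 1 0 2 3 x w] x w by (simp add: F_def)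
  qed
  have S5: "((\<lambda>c. W5 c * F c) has_sum lat_sum w (2 * x + 1) (x + 2)) UNIV"
  proof -
    have "W5 (m * 2 + n * 1, m * 1 + n * 2) = half_wt m * half_wt n" for m n
      unfolding W5_def prod.case half_wt_def by (auto; presburger)
    moreover have "\<exists>m n. a = m * 2 + n * 1 \<and> b = m * 1 + n * 2" if "W5 (a, b) \<noteq> 0" for a b
    proof -
      have c: "b \<le> 2 * a \<and> a \<le> 2 * b \<and> 3 dvd (a + b)"
        using that by (auto simp only: W5_def prod.case split: if_splits)
      then obtain k where "a + b = 3 * k" by (blast elim: dvdE)
      with c show ?thesis by (intro exI[of _ "a - k"] exI[of _ "b - k"]) linarith
    qed
    ultimately show ?thesis
      using lat_sum_reindex[of W5 2 1 1 2 x w] x w by (simp add: F_def)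
  qed
  have S6: "((\<lambda>c. W6 c * F c) has_sum lat_sum w (3 * x) (x + 1)) UNIV"
  proof -
    have "W6 (m * 3 + n * 1, m * 0 + n * 1) = half_wt m * half_wt n" for m n
      unfolding W6_def prod.case half_wt_def by (auto; presburger)
    moreover have "\<exists>m n. a = m * 3 + n * 1 \<and> b = m * 0 + n * 1" if "W6 (a, b) \<noteq> 0" for a b
    proof -
      have c: "b \<le> a \<and> 3 dvd (a + 2 * b)"
        using that by (auto simp only: W6_def prod.case split: if_splits)
      then obtain k where "a + 2 * b = 3 * k" by (blast elim: dvdE)
      with c show ?thesis by (intro exI[of _ "k - b"] exI[of _ "b"]) linarith
    qed
    ultimately show ?thesis
      using lat_sum_reindex[of W6 3 1 0 1 x w] x w by (simp add: F_def)
  qed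
  have S7: "((\<lambda>c. W7 c * F c) has_sum lat_sum w (3 * x) (2 * x + 1)) UNIV"
  proof -
    have "W7 (m * 3 + n * 2, m * 0 + n * 1) = half_wt m * half_wt n" for m n
      unfolding W7_def prod.case half_wt_def by (auto; presburger)
    moreover have "\<exists>m n. a = m * 3 + n * 2 \<and> b = m * 0 + n * 1" if "W7 (a, b) \<noteq> 0" for a b
    proof -
      have c: "2 * b \<le> a \<and> 3 dvd (a + b)"
        using that by (auto simp only: W7_def prod.case split: if_splits)
      then obtain k where "a + b = 3 * k" by (blast elim: dvdE)
      with c show ?thesis by (intro exI[of _ "k - b"] exI[of _ "b"]) linarith
    qed
    ultimately show ?thesis
      using lat_sum_reindex[of W7 3 2 0 1 x w] x w by (simp add: F_def)
  qed
  have S8: "((\<lambda>c. W8 c * F c) has_sum lat_sum w (3 * x) 3) UNIV"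
  proof -
    have "W8 (m * 3 + n * 0, m * 0 + n * 3) = half_wt m * half_wt n" for m n
      unfolding W8_def prod.case half_wt_def by (auto; presburger)
    moreover have "\<exists>m n. a = m * 3 + n * 0 \<and> b = m * 0 + n * 3" if "W8 (a, b) \<noteq> 0" for a b
    proof -
      have c: "3 dvd a \<and> 3 dvd b"
        using that by (auto simp only: W8_def prod.case split: if_splits)
      then show ?thesis by (intro exI[of _ "a div 3"] exI[of _ "b div 3"]) auto
    qed
    ultimately show ?thesis
      using lat_sum_reindex[of W8 3 0 0 3 x w] x w by (simp add: F_def)
  qed
  have F0: "F (0, 0) = 0" by (simp add: F_def)
  have "W1 c + W2 c + W3 c + W4 c + W5 c + W6 c + W7 c = E c + 3 * W8 c" if "c \<noteq> (0, 0)" for c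
  proof -
    obtain a b where c: "c = (a, b)" by fastforce
    have 1: "W3 c + W6 c = (if 3 dvd (a + 2 * b) then half_wt a * half_wt b else 0)"
      using that by (auto simp: c W3_def W6_def half_wt_def)
    have 2: "W4 c + W5 c + W7 c = (if 3 dvd (a + b) then half_wt a * half_wt b else 0)"
      using that by (auto simp: c W4_def W5_def W7_def half_wt_def)
    have "W1 c + W2 c + (W3 c + W6 c) + (W4 c + W5 c + W7 c) = E c + 3 * W8 c"
      unfolding 1 2 unfolding c W1_def W2_def W8_def E_def prod.case
      by (cases "3 dvd a"; cases "3 dvd b"; cases "3 dvd (a + b)"; cases "3 dvd (a + 2 * b)"; simp; presburger)
    then show ?thesis by (simp add: add_ac)
  qed
  then have eq: "(W1 c + W2 c + W3 c + W4 c + W5 c + W6 c + W7 c) * F c = (E c + 3 * W8 c) * F c" for c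
    using F0 by (cases "c = (0, 0)") auto
  have "((\<lambda>c. W1 c * F c + W2 c * F c + W3 c * F c + W4 c * F c + W5 c * F c + W6 c * F c + W7 c * F c) has_sum
       lat_sum w (3 * x) 1 + lat_sum w x 3 + lat_sum w (x + 1) 3 + lat_sum w (x + 2) 3
         + lat_sum w (2 * x + 1) (x + 2) + lat_sum w (3 * x) (x + 1) + lat_sum w (3 * x) (2 * x + 1)) UNIV"
    by (intro has_sum_add S1 S2 S3 S4 S5 S6 S7)
  moreover have "((\<lambda>c. E c * F c + 3 * (W8 c * F c)) has_sum lat_sum w x 1 + 3 * lat_sum w (3 * x) 3) UNIV"
    by (intro has_sum_add has_sum_cmult_right S S8)
  moreover have "(\<lambda>c. W1 c * F c + W2 c * F c + W3 c * F c + W4 c * F c + W5 c * F c + W6 c * F c + W7 c * F c)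
      = (\<lambda>c. E c * F c + 3 * (W8 c * F c))"
    using eq by (simp add: algebra_simps)
  ultimately show ?thesis
    by (simp only:) (erule (1) has_sum_unique)
qed

section \<open>From lattice identities to relations between the functions F_k\<close>

lemma divisor_sigma_prime:
  assumes "prime p"
  shows "divisor_sigma z p = 1 + of_nat p powr z"
proof -
  have "{d. d dvd p} = {1, p}" using assms by (auto simp: prime_nat_iff)
  moreover have "p \<noteq> 1" using assms by auto
  ultimately show ?thesis by (simp add: divisor_sigma_def)
qed

text \<open>Homogeneity normalizes the second value of the linear form to 1. The factor
  \<open>c powr (-w)\<close> split off here is the origin of all powers of logarithms in the
  relations.\<close>

lemma eisen_period_scale:
  assumes "c > 0" "\<alpha> > 0" "Re w > 2"
  shows "of_real c powr (0 - w) * eisen_period (\<alpha> / c) w = (w - 1) * lat_sum w \<alpha> c"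
  using lat_sum_scale[of c "\<alpha> / c" 1 w] eisen_period_eq_lat_sum[of "\<alpha> / c" w] assms by simp

text \<open>Since \<open>p powr (1 - w) = p * p powr (-w)\<close>, the divisor \<open>p\<close>
  accounts for the \<open>p\<close> additional counts of the points divisible by
  \<open>p\<close>.\<close>

lemma eisen_period_sigma:
  assumes "prime p" "x > 0" "Re w > 2"
  shows "divisor_sigma (1 - w) p * eisen_period x w
       = (w - 1) * (lat_sum w x 1 + of_nat p * lat_sum w (real p * x) (real p))"
proof -
  have p: "real p > 0" using assms(1) prime_gt_0_nat by simp
  have "of_nat p powr (1 - w) = (of_nat p * of_real (real p) powr (-w) :: complex)"
    using p by (simp add: powr_diff powr_minus_divide)
  then show ?thesis
    using lat_sum_scale[of "real p" x 1 w] p assms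
    by (simp add: divisor_sigma_prime eisen_period_eq_lat_sum algebra_simps)
qed

text \<open>Each cone of a Hecke relation enters as a pair \<open>c i\<close>, \<open>y i\<close>.
  Deleting the pole \<open>w = 2\<close> leaves the half plane connected, so the relation reaches
  \<open>w = 1\<close>; the common factor \<open>- of_nat k\<close> of all derivatives then
  cancels.\<close>

lemma calF_relation:
  fixes c y :: "'i \<Rightarrow> real"
  assumes k: "k \<ge> 1" and I: "finite I" and X: "X > 0" and x: "x > 0" and p: "prime p"
    and c: "\<And>i. i \<in> I \<Longrightarrow> c i > 0" and y: "\<And>i. i \<in> I \<Longrightarrow> y i > 0"
    and hecke: "\<And>w. Re w > 2 \<Longrightarrow> eisen_period X w = divisor_sigma (1 - w) p * eisen_period x w
            - (\<Sum>i\<in>I. of_real (c i) powr (0 - w) * eisen_period (y i) w)"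
  shows "calF k (of_real X) = (\<Sum>j=1..k. of_nat ((k - 1) choose (j - 1)) *
      (sigma0_deriv (k - j) p * calF j (of_real x)
        - (\<Sum>i\<in>I. of_real (1 / c i * ln (1 / c i) ^ (k - j)) * calF j (of_real (y i)))))"
proof -
  let ?A = "{w. Re w > 0} - {2}"
  have A: "open ?A" "1 \<in> ?A" by (auto intro: open_delete open_halfspace_Re_gt)
  have sigma: "(\<lambda>w. divisor_sigma (1 - w) p) holomorphic_on B" for B
    unfolding divisor_sigma_def by (intro holomorphic_intros)
  have hol1: "(\<lambda>w. divisor_sigma (1 - w) p * eisen_period x w) holomorphic_on ?A"
    by (intro holomorphic_intros sigma eisen_period_holomorphic x)
  have hol2: "(\<lambda>w. of_real (c i) powr (0 - w) * eisen_period (y i) w) holomorphic_on ?A" if "i \<in> I" for i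
    using c[OF that] y[OF that] by (intro holomorphic_intros eisen_period_holomorphic) auto
  have hol3: "(\<lambda>w. \<Sum>i\<in>I. of_real (c i) powr (0 - w) * eisen_period (y i) w) holomorphic_on ?A"
    by (intro holomorphic_on_sum hol2)
  have eq: "eisen_period X w = divisor_sigma (1 - w) p * eisen_period x w
            - (\<Sum>i\<in>I. of_real (c i) powr (0 - w) * eisen_period (y i) w)" if "w \<in> ?A" for w
  proof (rule analytic_continuation_open[of "{w. Re w > 2}" ?A "eisen_period X"])
    show "connected ?A"
      by (intro connected_open_delete convex_connected convex_halfspace_Re_gt open_halfspace_Re_gt) auto
    show "{w. Re w > 2} \<noteq> {}" by (auto intro: exI[of _ 3])
    show "(\<lambda>w. divisor_sigma (1 - w) p * eisen_period x w
        - (\<Sum>i\<in>I. of_real (c i) powr (0 - w) * eisen_period (y i) w)) holomorphic_on ?A"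
      by (rule holomorphic_on_diff[OF hol1 hol3])
  qed (use that A hecke in \<open>auto intro!: eisen_period_holomorphic X open_halfspace_Re_gt\<close>)
  have coeff: "(deriv ^^ n) (\<lambda>w. of_real (c i) powr (0 - w)) 1 = complex_of_real (1 / c i * ln (1 / c i) ^ n)"
    if "i \<in> I" for i n
    using c[OF that]
    by (subst higher_deriv_powr_diff) (simp_all add: powr_minus_divide ln_div Ln_of_real)
  have "(deriv ^^ k) (eisen_period X) 1 = (deriv ^^ k) (\<lambda>w. divisor_sigma (1 - w) p * eisen_period x w
            - (\<Sum>i\<in>I. of_real (c i) powr (0 - w) * eisen_period (y i) w)) 1"
    by (rule higher_deriv_transform_within_open[OF eisen_period_holomorphic[OF X] holomorphic_on_diff[OF hol1 hol3] A eq])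
  also have "\<dots> = (deriv ^^ k) (\<lambda>w. divisor_sigma (1 - w) p * eisen_period x w) 1
      - (\<Sum>i\<in>I. (deriv ^^ k) (\<lambda>w. of_real (c i) powr (0 - w) * eisen_period (y i) w) 1)"
    by (simp only: higher_deriv_diff[OF hol1 hol3 A] higher_deriv_finite_sum[OF I hol2 A])
  also have "(\<Sum>i\<in>I. (deriv ^^ k) (\<lambda>w. of_real (c i) powr (0 - w) * eisen_period (y i) w) 1)
      = (\<Sum>i\<in>I. - of_nat k * (\<Sum>j=1..k. of_nat ((k - 1) choose (j - 1)) *
            (of_real (1 / c i * ln (1 / c i) ^ (k - j)) * calF j (of_real (y i)))))"
  proof (intro sum.cong refl)
    fix i assume i: "i \<in> I"
    have "(\<lambda>w. of_real (c i) powr (0 - w)) holomorphic_on UNIV"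
      using c[OF i] by (intro holomorphic_intros) auto
    from higher_deriv_mult_eisen_period[OF y[OF i] this, of k]
    show "(deriv ^^ k) (\<lambda>w. of_real (c i) powr (0 - w) * eisen_period (y i) w) 1
      = - of_nat k * (\<Sum>j=1..k. of_nat ((k - 1) choose (j - 1)) *
            (of_real (1 / c i * ln (1 / c i) ^ (k - j)) * calF j (of_real (y i))))"
      by (simp only: coeff[OF i])
  qed
  also have "(deriv ^^ k) (\<lambda>w. divisor_sigma (1 - w) p * eisen_period x w) 1
      = - of_nat k * (\<Sum>j=1..k. of_nat ((k - 1) choose (j - 1)) * (sigma0_deriv (k - j) p * calF j (of_real x)))"
    unfolding sigma0_deriv_def by (rule higher_deriv_mult_eisen_period[OF x sigma])
  finally have "- of_nat k * calF k (of_real X) = - of_nat k *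
     ((\<Sum>j=1..k. of_nat ((k - 1) choose (j - 1)) * (sigma0_deriv (k - j) p * calF j (of_real x)))
      - (\<Sum>i\<in>I. \<Sum>j=1..k. of_nat ((k - 1) choose (j - 1)) *
            (of_real (1 / c i * ln (1 / c i) ^ (k - j)) * calF j (of_real (y i)))))"
    by (simp only: eisen_period_deriv[OF X] right_diff_distrib sum_distrib_left mult_minus_left)
  then have "calF k (of_real X) =
     (\<Sum>j=1..k. of_nat ((k - 1) choose (j - 1)) * (sigma0_deriv (k - j) p * calF j (of_real x)))
      - (\<Sum>i\<in>I. \<Sum>j=1..k. of_nat ((k - 1) choose (j - 1)) *
            (of_real (1 / c i * ln (1 / c i) ^ (k - j)) * calF j (of_real (y i))))"
    using k by (simp only: mult_cancel_left) simp
  then show ?thesis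
    by (subst (asm) sum.swap) (simp only: right_diff_distrib sum_subtractf sum_distrib_left)
qed

theorem corollary1p5:
  fixes k :: nat and x :: real
  assumes "k \<ge> 1" and "x > 0"
  shows
    "calF k (complex_of_real (2 * x)) =
       (\<Sum>j=1..k. of_nat ((k - 1) choose (j - 1)) *
          (sigma0_deriv (k - j) 2 * calF j (complex_of_real x)
           - 1 / 2 * complex_of_real (ln (1 / 2) ^ (k - j)) * calF j (complex_of_real (x / 2))
           - 1 / 2 * complex_of_real (ln (1 / 2) ^ (k - j)) * calF j (complex_of_real ((x + 1) / 2))
           - complex_of_real (1 / (x + 1) * ln (1 / (x + 1)) ^ (k - j))
               * calF j (complex_of_real (2 * x / (x + 1)))))
     \<and>
     calF k (complex_of_real (3 * x)) =
       (\<Sum>j=1..k. of_nat ((k - 1) choose (j - 1)) *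
          (sigma0_deriv (k - j) 3 * calF j (complex_of_real x)
           - 1 / 3 * complex_of_real (ln (1 / 3) ^ (k - j))
               * (\<Sum>p=0..2::nat. calF j (complex_of_real ((x + real p) / 3)))
           - complex_of_real (1 / (x + 2) * ln (1 / (x + 2)) ^ (k - j))
               * calF j (complex_of_real ((2 * x + 1) / (x + 2)))
           - (\<Sum>p=1..2::nat. complex_of_real (1 / (real p * x + 1) * ln (1 / (real p * x + 1)) ^ (k - j))
               * calF j (complex_of_real (3 * x / (real p * x + 1))))))"
proof
  \<comment> \<open>On the edge vectors of cone \<open>i\<close> the form \<open>a x + b\<close>
    takes the values \<open>c2 i * y2 i\<close> and \<open>c2 i\<close>. The remaining lattice, with
    values \<open>2 * x\<close> and 1, is the left-hand side of the relation.\<close>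
  define c2 where "c2 = (\<lambda>i::nat. [2, 2, x + 1] ! i)"
  define y2 where "y2 = (\<lambda>i::nat. [x, x + 1, 2 * x] ! i / c2 i)"
  have I2: "{..<3} = {0, 1, 2 :: nat}" by auto
  have "calF k (of_real (2 * x)) = (\<Sum>j=1..k. of_nat ((k - 1) choose (j - 1)) *
      (sigma0_deriv (k - j) 2 * calF j (of_real x)
        - (\<Sum>i<3. of_real (1 / c2 i * ln (1 / c2 i) ^ (k - j)) * calF j (of_real (y2 i)))))"
  proof (rule calF_relation)
    show "eisen_period (2 * x) w = divisor_sigma (1 - w) 2 * eisen_period x w
            - (\<Sum>i<3. of_real (c2 i) powr (0 - w) * eisen_period (y2 i) w)" if w: "Re w > 2" for w
    proof -
      have "(\<Sum>i<3. of_real (c2 i) powr (0 - w) * eisen_period (y2 i) w)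
         = (w - 1) * (lat_sum w x 2 + lat_sum w (x + 1) 2 + lat_sum w (2 * x) (x + 1))"
        unfolding I2 y2_def
        using eisen_period_scale[of 2 x w] eisen_period_scale[of 2 "x + 1" w] eisen_period_scale[of "x + 1" "2 * x" w] assms(2) w
        by (simp add: c2_def distrib_left add_ac)
      moreover have "divisor_sigma (1 - w) 2 * eisen_period x w = (w - 1) * (lat_sum w x 1 + 2 * lat_sum w (2 * x) 2)"
        using eisen_period_sigma[of 2 x w] assms(2) w by simp
      moreover have "eisen_period (2 * x) w = (w - 1) * lat_sum w (2 * x) 1"
        using assms(2) w by (intro eisen_period_eq_lat_sum) auto
      ultimately show ?thesis
        unfolding lat_sum_hecke_2[OF assms(2) w, symmetric] right_diff_distrib[symmetric]
        by (simp only: right_diff_distrib[symmetric]) (simp add: algebra_simps)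
    qed
  qed (use assms in \<open>auto simp: I2 c2_def y2_def\<close>)
  then show "calF k (complex_of_real (2 * x)) =
       (\<Sum>j=1..k. of_nat ((k - 1) choose (j - 1)) *
          (sigma0_deriv (k - j) 2 * calF j (complex_of_real x)
           - 1 / 2 * complex_of_real (ln (1 / 2) ^ (k - j)) * calF j (complex_of_real (x / 2))
           - 1 / 2 * complex_of_real (ln (1 / 2) ^ (k - j)) * calF j (complex_of_real ((x + 1) / 2))
           - complex_of_real (1 / (x + 1) * ln (1 / (x + 1)) ^ (k - j))
               * calF j (complex_of_real (2 * x / (x + 1)))))"
    by (simp add: I2 c2_def y2_def diff_diff_eq add_ac)
next
  \<comment> \<open>The first three entries are the terms \<open>(x + p) / 3\<close>; the others are
    the cone between \<open>(2, 1)\<close> and \<open>(1, 2)\<close> and the two cones that contain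
    the edge \<open>(3, 0)\<close> and a ray inside the quadrant.\<close>
  define c3 where "c3 = (\<lambda>i::nat. [3, 3, 3, x + 2, x + 1, 2 * x + 1] ! i)"
  define y3 where "y3 = (\<lambda>i::nat. [x, x + 1, x + 2, 2 * x + 1, 3 * x, 3 * x] ! i / c3 i)"
  have I3: "{..<6} = {0, 1, 2, 3, 4, 5 :: nat}" by auto
  have "calF k (of_real (3 * x)) = (\<Sum>j=1..k. of_nat ((k - 1) choose (j - 1)) *
      (sigma0_deriv (k - j) 3 * calF j (of_real x)
        - (\<Sum>i<6. of_real (1 / c3 i * ln (1 / c3 i) ^ (k - j)) * calF j (of_real (y3 i)))))"
  proof (rule calF_relation)
    show "eisen_period (3 * x) w = divisor_sigma (1 - w) 3 * eisen_period x w
            - (\<Sum>i<6. of_real (c3 i) powr (0 - w) * eisen_period (y3 i) w)" if w: "Re w > 2" for w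
    proof -
      have "(\<Sum>i<6. of_real (c3 i) powr (0 - w) * eisen_period (y3 i) w)
         = (w - 1) * (lat_sum w x 3 + lat_sum w (x + 1) 3 + lat_sum w (x + 2) 3
             + lat_sum w (2 * x + 1) (x + 2) + lat_sum w (3 * x) (x + 1) + lat_sum w (3 * x) (2 * x + 1))"
        unfolding I3 y3_def
        using eisen_period_scale[of 3 x w] eisen_period_scale[of 3 "x + 1" w] eisen_period_scale[of 3 "x + 2" w]
          eisen_period_scale[of "x + 2" "2 * x + 1" w] eisen_period_scale[of "x + 1" "3 * x" w]
          eisen_period_scale[of "2 * x + 1" "3 * x" w] assms(2) w
        by (simp add: c3_def distrib_left add_ac)
      moreover have "divisor_sigma (1 - w) 3 * eisen_period x w = (w - 1) * (lat_sum w x 1 + 3 * lat_sum w (3 * x) 3)"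
        using eisen_period_sigma[of 3 x w] assms(2) w by simp
      moreover have "eisen_period (3 * x) w = (w - 1) * lat_sum w (3 * x) 1"
        using assms(2) w by (intro eisen_period_eq_lat_sum) auto
      ultimately show ?thesis
        unfolding lat_sum_hecke_3[OF assms(2) w, symmetric] right_diff_distrib[symmetric]
        by (simp only: right_diff_distrib[symmetric]) (simp add: algebra_simps)
    qed
  qed (use assms in \<open>auto simp: I3 c3_def y3_def\<close>)
  moreover have "{0..2} = {0, 1, 2 :: nat}" "{1..2} = {1, 2 :: nat}" by auto
  ultimately show "calF k (complex_of_real (3 * x)) =
       (\<Sum>j=1..k. of_nat ((k - 1) choose (j - 1)) *
          (sigma0_deriv (k - j) 3 * calF j (complex_of_real x)
           - 1 / 3 * complex_of_real (ln (1 / 3) ^ (k - j))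
               * (\<Sum>p=0..2::nat. calF j (complex_of_real ((x + real p) / 3)))
           - complex_of_real (1 / (x + 2) * ln (1 / (x + 2)) ^ (k - j))
               * calF j (complex_of_real ((2 * x + 1) / (x + 2)))
           - (\<Sum>p=1..2::nat. complex_of_real (1 / (real p * x + 1) * ln (1 / (real p * x + 1)) ^ (k - j))
               * calF j (complex_of_real (3 * x / (real p * x + 1))))))"
    by (simp add: I3 c3_def y3_def diff_diff_eq distrib_left add_ac)
qed

end
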